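(* Let $E$ be an arbitrary directed graph and $K$ a field. If $w$ is a sink in $E$, then the annihilator in $L_K(E)$ of the simple left module $\mathbf N_w$ is $I(H(w),B_{H(w)})$.
   Context: A directed graph $E=(E^0,E^1,r,s)$ consists of sets $E^0$ (vertices), $E^1$ (edges), of any cardinality, and maps $r,s:E^1\to E^0$. A vertex $v$ is a sink if $s^{-1}(v)=\emptyset$, regular if $s^{-1}(v)$ is finite and non-empty, an infinite emitter if $s^{-1}(v)$ is infinite. Vertices are paths of length $0$; $u\ge v$ means there is a path from $u$ to $v$. $L_K(E)$ (Leavitt path algebra) is the $K$-algebra generated by pairwise orthogonal idempotents $v\in E^0$ and elements $e,e^*$ ($e\in E^1$) with relations: $s(e)e=e=er(e)$; $r(e)e^*=e^*=e^*s(e)$; $e^*e=r(e)$ and $e^*f=0$ for $e\ne f$; $v=\sum_{s(e)=v}ee^*$ for every regular vertex $v$. $H(w)=E^0\setminus\{u\in E^0:u\ge w\}$; for $w$ a sink this is a hereditary saturated set (hereditary: $u\in H,u\ge u'$ imply $u'\in H$; saturated: a regular $u$ with $r(s^{-1}(u))\subseteq H$ lies in $H$). For a hereditary saturated $H$, $B_H$ is the set of infinite emitters $u\in E^0\setminus H$ with $1\le|s^{-1}(u)\cap r^{-1}(E^0\setminus H)|<\infty$; for $u\in B_H$, $u^H=u-\sum_{s(e)=u,\,r(e)\notin H}ee^*$; for $S\subseteq B_H$, $I(H,S)$ is the two-sided ideal of $L_K(E)$ generated by $H\cup\{u^H:u\in S\}$. $\mathbf N_w$ is the $K$-vector space with basis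 all finite paths in $E$ ending in $w$, with left $L_K(E)$-action on a basis path $q$: $v\cdot q=q$ if $v=s(q)$, else $0$; $e\cdot q=eq$ if $r(e)=s(q)$, else $0$; $e^*\cdot q=q'$ if $q=eq'$, else $0$ (so $e^*\cdot w=0$). It is a simple module. *)

theory Defs
  imports "HOL-Library.Poly_Mapping" "Graph_Theory.Arc_Walk"
begin

section \<open>Algebras without unit, two-sided ideals, quotients\<close>

text \<open>
  The rings of HOL-Algebra are unital, whereas a Leavitt path algebra has no unit
  when the graph has infinitely many vertices.
\<close>

record ('k, 'a) alg =
  carrier :: "'a set"
  azero :: 'a
  aplus :: "'a \<Rightarrow> 'a \<Rightarrow> 'a"
  atimes :: "'a \<Rightarrow> 'a \<Rightarrow> 'a"
  ascale :: "'k \<Rightarrow> 'a \<Rightarrow> 'a"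

definition alg_ideal :: "('k, 'a) alg \<Rightarrow> 'a set \<Rightarrow> bool" where
  "alg_ideal A I \<longleftrightarrow> I \<subseteq> carrier A \<and> azero A \<in> I \<and>
     (\<forall>a\<in>I. \<forall>b\<in>I. aplus A a b \<in> I) \<and> (\<forall>c. \<forall>a\<in>I. ascale A c a \<in> I) \<and>
     (\<forall>a\<in>I. \<forall>b\<in>carrier A. atimes A a b \<in> I \<and> atimes A b a \<in> I)"

definition ideal_gen :: "('k, 'a) alg \<Rightarrow> 'a set \<Rightarrow> 'a set" where
  "ideal_gen A S = \<Inter>{I. alg_ideal A I \<and> S \<subseteq> I}"

definition coset :: "('k, 'a) alg \<Rightarrow> 'a set \<Rightarrow> 'a \<Rightarrow> 'a set" where
  "coset A J a = aplus A a ` J"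

text \<open>
  For an ideal \<open>J\<close>, each of the unions below is a union of copies of a single coset; lemma
  \<open>lpa_ops\<close> below verifies this in the case that is used.
\<close>

definition quot :: "('k, 'a) alg \<Rightarrow> 'a set \<Rightarrow> ('k, 'a set) alg" where
  "quot A J =
    \<lparr> carrier = coset A J ` carrier A,
      azero = coset A J (azero A),
      aplus = (\<lambda>X Y. \<Union>a\<in>X. \<Union>b\<in>Y. coset A J (aplus A a b)),
      atimes = (\<lambda>X Y. \<Union>a\<in>X. \<Union>b\<in>Y. coset A J (atimes A a b)),
      ascale = (\<lambda>c X. \<Union>a\<in>X. coset A J (ascale A c a)) \<rparr>"

definition annihilator :: "('k, 'a) alg \<Rightarrow> ('a \<Rightarrow> 'm \<Rightarrow> 'm) \<Rightarrow> 'm::zero set \<Rightarrow> 'a set" where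
  "annihilator A act M = {a \<in> carrier A. \<forall>x\<in>M. act a x = 0}"


section \<open>Free algebras\<close>

datatype 'g word = Word (letters: "'g list")

instantiation word :: (type) monoid_add
begin

definition zero_word :: "'a word" where
  "0 = Word []"

definition plus_word :: "'a word \<Rightarrow> 'a word \<Rightarrow> 'a word" where
  "u + v = Word (letters u @ letters v)"

instance
  by standard (simp_all add: zero_word_def plus_word_def)

end

abbreviation smul :: "'k::field \<Rightarrow> ('b \<Rightarrow>\<^sub>0 'k) \<Rightarrow> ('b \<Rightarrow>\<^sub>0 'k)" where
  "smul c \<equiv> Poly_Mapping.map ((*) c)"

text \<open>
  The free (non-unital) algebra on \<open>X\<close>: its basis consists of the non-empty words in \<open>X\<close>;
  the product of \<^typ>\<open>'g word \<Rightarrow>\<^sub>0 'k\<close> is the bilinear extension of concatenation.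
\<close>

definition free_alg :: "'g set \<Rightarrow> ('k::field, 'g word \<Rightarrow>\<^sub>0 'k) alg" where
  "free_alg X =
    \<lparr> carrier = {a. \<forall>m\<in>Poly_Mapping.keys a. letters m \<noteq> [] \<and> set (letters m) \<subseteq> X},
      azero = 0, aplus = (+), atimes = (*), ascale = smul \<rparr>"


section \<open>Leavitt path algebras\<close>

text \<open>\<open>Ed e\<close> and \<open>Gh e\<close> stand for \<open>e\<close> and \<open>e\<^sup>*\<close>.\<close>

datatype ('v, 'e) lpa_gen = Vx 'v | Ed 'e | Gh 'e

type_synonym ('v, 'e, 'k) lpa_free = "('v, 'e) lpa_gen word \<Rightarrow>\<^sub>0 'k"
type_synonym ('v, 'e, 'k) lpa_elem = "('v, 'e, 'k) lpa_free set"

definition gens :: "('v, 'e) pre_digraph \<Rightarrow> ('v, 'e) lpa_gen set" where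
  "gens E = Vx ` verts E \<union> Ed ` arcs E \<union> Gh ` arcs E"

abbreviation letter :: "'g \<Rightarrow> ('g word \<Rightarrow>\<^sub>0 'k::field)" where
  "letter g \<equiv> Poly_Mapping.single (Word [g]) 1"

abbreviation vx :: "'v \<Rightarrow> ('v, 'e, 'k::field) lpa_free" where "vx v \<equiv> letter (Vx v)"
abbreviation ed :: "'e \<Rightarrow> ('v, 'e, 'k::field) lpa_free" where "ed e \<equiv> letter (Ed e)"
abbreviation gh :: "'e \<Rightarrow> ('v, 'e, 'k::field) lpa_free" where "gh e \<equiv> letter (Gh e)"

definition sink :: "('v, 'e) pre_digraph \<Rightarrow> 'v \<Rightarrow> bool" where
  "sink E v \<longleftrightarrow> v \<in> verts E \<and> out_arcs E v = {}"

definition regular :: "('v, 'e) pre_digraph \<Rightarrow> 'v \<Rightarrow> bool" where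
  "regular E v \<longleftrightarrow> v \<in> verts E \<and> finite (out_arcs E v) \<and> out_arcs E v \<noteq> {}"

definition infinite_emitter :: "('v, 'e) pre_digraph \<Rightarrow> 'v \<Rightarrow> bool" where
  "infinite_emitter E v \<longleftrightarrow> v \<in> verts E \<and> infinite (out_arcs E v)"

definition lpa_rels :: "('v, 'e) pre_digraph \<Rightarrow> ('v, 'e, 'k::field) lpa_free set" where
  "lpa_rels E =
     {vx v * vx v - vx v | v. v \<in> verts E} \<union>
     {vx u * vx v | u v. u \<in> verts E \<and> v \<in> verts E \<and> u \<noteq> v} \<union>
     {vx (tail E e) * ed e - ed e | e. e \<in> arcs E} \<union>
     {ed e * vx (head E e) - ed e | e. e \<in> arcs E} \<union>
     {vx (head E e) * gh e - gh e | e. e \<in> arcs E} \<union>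
     {gh e * vx (tail E e) - gh e | e. e \<in> arcs E} \<union>
     {gh e * ed e - vx (head E e) | e. e \<in> arcs E} \<union>
     {gh e * ed f | e f. e \<in> arcs E \<and> f \<in> arcs E \<and> e \<noteq> f} \<union>
     {vx v - (\<Sum>e\<in>out_arcs E v. ed e * gh e) | v. regular E v}"

definition lpa_rel_ideal :: "('v, 'e) pre_digraph \<Rightarrow> ('v, 'e, 'k::field) lpa_free set" where
  "lpa_rel_ideal E = ideal_gen (free_alg (gens E)) (lpa_rels E)"

definition lpa :: "('v, 'e) pre_digraph \<Rightarrow> ('k::field, ('v, 'e, 'k) lpa_elem) alg" where
  "lpa E = quot (free_alg (gens E)) (lpa_rel_ideal E)"

definition lpa_class ::
    "('v, 'e) pre_digraph \<Rightarrow> ('v, 'e, 'k::field) lpa_free \<Rightarrow> ('v, 'e, 'k) lpa_elem" where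
  "lpa_class E a = coset (free_alg (gens E)) (lpa_rel_ideal E) a"


section \<open>The ideals \<open>I(H,S)\<close>\<close>

definition path_ge :: "('v, 'e) pre_digraph \<Rightarrow> 'v \<Rightarrow> 'v \<Rightarrow> bool" where
  "path_ge E u v \<longleftrightarrow> (\<exists>p. pre_digraph.awalk E u p v)"

definition hereditary :: "('v, 'e) pre_digraph \<Rightarrow> 'v set \<Rightarrow> bool" where
  "hereditary E H \<longleftrightarrow> H \<subseteq> verts E \<and> (\<forall>u\<in>H. \<forall>u'. path_ge E u u' \<longrightarrow> u' \<in> H)"

definition saturated :: "('v, 'e) pre_digraph \<Rightarrow> 'v set \<Rightarrow> bool" where
  "saturated E H \<longleftrightarrow> (\<forall>u. regular E u \<and> head E ` out_arcs E u \<subseteq> H \<longrightarrow> u \<in> H)"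

definition H_of :: "('v, 'e) pre_digraph \<Rightarrow> 'v \<Rightarrow> 'v set" where
  "H_of E w = verts E - {u \<in> verts E. path_ge E u w}"

definition arcs_outside :: "('v, 'e) pre_digraph \<Rightarrow> 'v set \<Rightarrow> 'v \<Rightarrow> 'e set" where
  "arcs_outside E H u = {e \<in> out_arcs E u. head E e \<in> verts E - H}"

definition breaking :: "('v, 'e) pre_digraph \<Rightarrow> 'v set \<Rightarrow> 'v set" where
  "breaking E H = {u \<in> verts E - H. infinite_emitter E u \<and>
     finite (arcs_outside E H u) \<and> 1 \<le> card (arcs_outside E H u)}"

definition gap :: "('v, 'e) pre_digraph \<Rightarrow> 'v set \<Rightarrow> 'v \<Rightarrow> ('v, 'e, 'k::field) lpa_free" where
  "gap E H u = vx u - (\<Sum>e\<in>arcs_outside E H u. ed e * gh e)"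

definition lpa_ideal ::
    "('v, 'e) pre_digraph \<Rightarrow> 'v set \<Rightarrow> 'v set \<Rightarrow> ('v, 'e, 'k::field) lpa_elem set" where
  "lpa_ideal E H S = ideal_gen (lpa E)
     ((\<lambda>v. lpa_class E (vx v)) ` H \<union> (\<lambda>u. lpa_class E (gap E H u)) ` S)"


section \<open>The module \<open>N\<^sub>w\<close>\<close>

text \<open>
  A path is a pair of its source and its list of arcs, so that the vertices are the pairs
  \<open>(v, [])\<close>.
\<close>

type_synonym ('v, 'e) path = "'v \<times> 'e list"
type_synonym ('v, 'e, 'k) path_vec = "('v, 'e) path \<Rightarrow>\<^sub>0 'k"

definition path_mod :: "('v, 'e) pre_digraph \<Rightarrow> 'v \<Rightarrow> ('v, 'e, 'k::field) path_vec set" where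
  "path_mod E w = {x. \<forall>(u, p)\<in>Poly_Mapping.keys x. pre_digraph.awalk E u p w}"

fun gen_act :: "('v, 'e) pre_digraph \<Rightarrow> ('v, 'e) lpa_gen \<Rightarrow> ('v, 'e) path
    \<Rightarrow> ('v, 'e, 'k::field) path_vec" where
  "gen_act E (Vx v) (u, p) = (if v = u then Poly_Mapping.single (u, p) 1 else 0)"
| "gen_act E (Ed e) (u, p) =
     (if head E e = u then Poly_Mapping.single (tail E e, e # p) 1 else 0)"
| "gen_act E (Gh e) (u, []) = 0"
| "gen_act E (Gh e) (u, f # p) = (if f = e then Poly_Mapping.single (head E e, p) 1 else 0)"

definition lin_ext :: "('b \<Rightarrow> 'c \<Rightarrow>\<^sub>0 'k::field) \<Rightarrow> ('b \<Rightarrow>\<^sub>0 'k) \<Rightarrow> ('c \<Rightarrow>\<^sub>0 'k)" where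
  "lin_ext f x = (\<Sum>q\<in>Poly_Mapping.keys x. smul (Poly_Mapping.lookup x q) (f q))"

definition word_act :: "('v, 'e) pre_digraph \<Rightarrow> ('v, 'e) lpa_gen word
    \<Rightarrow> ('v, 'e, 'k::field) path_vec \<Rightarrow> ('v, 'e, 'k) path_vec" where
  "word_act E m x = foldr (\<lambda>g. lin_ext (gen_act E g)) (letters m) x"

definition free_act :: "('v, 'e) pre_digraph \<Rightarrow> ('v, 'e, 'k::field) lpa_free
    \<Rightarrow> ('v, 'e, 'k) path_vec \<Rightarrow> ('v, 'e, 'k) path_vec" where
  "free_act E a x = lin_ext (\<lambda>m. word_act E m x) a"

text \<open>
  A class acts through any of its representatives; that the choice does not matter (for \<open>w\<close> a
  sink and vectors in \<^term>\<open>path_mod E w\<close>) is lemma \<open>lpa_act_class\<close> below.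
\<close>

definition lpa_act :: "('v, 'e) pre_digraph \<Rightarrow> ('v, 'e, 'k::field) lpa_elem
    \<Rightarrow> ('v, 'e, 'k) path_vec \<Rightarrow> ('v, 'e, 'k) path_vec" where
  "lpa_act E X x = the_elem ((\<lambda>a. free_act E a x) ` X)"


section \<open>Well-definedness\<close>

lemma lookup_smul [simp]: "Poly_Mapping.lookup (smul c x) k = c * Poly_Mapping.lookup x k"
  by (simp add: map.rep_eq when_def)

lemma smul_laws:
  "smul c (x + y) = smul c x + smul c y" "smul (c + d) x = smul c x + smul d x"
  "smul c (smul d x) = smul (c * d) x" "smul 1 x = x" "smul 0 x = 0" "smul c 0 = 0"
  by (rule poly_mapping_eqI; simp add: lookup_add algebra_simps)+

lemma smul_sum: "smul c (sum f A) = (\<Sum>i\<in>A. smul c (f i))"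
  by (rule poly_mapping_eqI) (simp add: lookup_sum sum_distrib_left)

lemma keys_smul: "Poly_Mapping.keys (smul c x) \<subseteq> Poly_Mapping.keys x"
  by (auto simp: in_keys_iff)

lemma lin_ext_superset:
  assumes "finite A" "Poly_Mapping.keys x \<subseteq> A"
  shows "lin_ext f x = (\<Sum>q\<in>A. smul (Poly_Mapping.lookup x q) (f q))"
  unfolding lin_ext_def using assms
  by (intro sum.mono_neutral_left) (auto simp: in_keys_iff smul_laws)

lemma lin_ext_zero [simp]: "lin_ext f 0 = 0"
  by (simp add: lin_ext_def)

lemma lin_ext_add: "lin_ext f (x + y) = lin_ext f x + lin_ext f y"
proof -
  let ?A = "Poly_Mapping.keys x \<union> Poly_Mapping.keys y"
  have "lin_ext f (x + y) = (\<Sum>q\<in>?A. smul (Poly_Mapping.lookup (x + y) q) (f q))"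
    by (rule lin_ext_superset) (auto simp: keys_add)
  moreover have "lin_ext f x = (\<Sum>q\<in>?A. smul (Poly_Mapping.lookup x q) (f q))"
    by (rule lin_ext_superset) auto
  moreover have "lin_ext f y = (\<Sum>q\<in>?A. smul (Poly_Mapping.lookup y q) (f q))"
    by (rule lin_ext_superset) auto
  ultimately show ?thesis
    by (simp add: lookup_add smul_laws sum.distrib)
qed

lemma lin_ext_smul: "lin_ext f (smul c x) = smul c (lin_ext f x)"
proof -
  have "lin_ext f (smul c x) = (\<Sum>q\<in>Poly_Mapping.keys x. smul (Poly_Mapping.lookup (smul c x) q) (f q))"
    by (rule lin_ext_superset) (auto simp: keys_smul)
  then show ?thesis
    by (simp add: lin_ext_def smul_sum smul_laws)
qed

lemma lin_ext_diff: "lin_ext f (x - y) = lin_ext f x - lin_ext f y"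
  using lin_ext_add[of f "x - y" y] by simp

lemma lin_ext_sum: "lin_ext f (sum g A) = (\<Sum>i\<in>A. lin_ext f (g i))"
  by (induction A rule: infinite_finite_induct) (simp_all add: lin_ext_add)

lemma lin_ext_single [simp]: "lin_ext f (Poly_Mapping.single q c) = smul c (f q)"
  using lin_ext_superset[of "{q}" "Poly_Mapping.single q c" f] by simp

lemma lin_ext_add_fun: "lin_ext (\<lambda>q. f q + g q) x = lin_ext f x + lin_ext g x"
  by (simp add: lin_ext_def smul_laws sum.distrib)

lemma poly_mapping_expand:
  fixes x :: "'b \<Rightarrow>\<^sub>0 'k::field"
  shows "x = (\<Sum>q\<in>Poly_Mapping.keys x. Poly_Mapping.single q (Poly_Mapping.lookup x q))"
  by (rule poly_mapping_eqI)
    (simp add: lookup_sum lookup_single when_def in_keys_iff sum.delta)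

lemma word_act_add: "word_act E m (x + y) = word_act E m x + word_act E m y"
proof -
  have "foldr (\<lambda>g. lin_ext (gen_act E g)) gs (x + y) =
      foldr (\<lambda>g. lin_ext (gen_act E g)) gs x + foldr (\<lambda>g. lin_ext (gen_act E g)) gs y" for gs
    by (induction gs) (simp_all add: lin_ext_add)
  then show ?thesis by (simp add: word_act_def)
qed

lemma word_act_smul: "word_act E m (smul c x) = smul c (word_act E m x)"
proof -
  have "foldr (\<lambda>g. lin_ext (gen_act E g)) gs (smul c x) =
      smul c (foldr (\<lambda>g. lin_ext (gen_act E g)) gs x)" for gs
    by (induction gs) (simp_all add: lin_ext_smul)
  then show ?thesis by (simp add: word_act_def)
qed

lemma word_act_zero [simp]: "word_act E m 0 = 0"
  using word_act_add[of E m 0 0] by simp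

lemma word_act_plus: "word_act E (m + n) x = word_act E m (word_act E n x)"
  by (simp add: word_act_def plus_word_def)

lemma word_act_sum: "word_act E m (sum f A) = (\<Sum>i\<in>A. word_act E m (f i))"
  by (induction A rule: infinite_finite_induct) (simp_all add: word_act_add)

lemmas free_act_left =
  lin_ext_add[of "\<lambda>m. word_act E m x" for E x, folded free_act_def]
  lin_ext_diff[of "\<lambda>m. word_act E m x" for E x, folded free_act_def]
  lin_ext_smul[of "\<lambda>m. word_act E m x" for E x, folded free_act_def]
  lin_ext_sum[of "\<lambda>m. word_act E m x" for E x, folded free_act_def]

lemma free_act_single [simp]:
  "free_act E (Poly_Mapping.single m c) x = smul c (word_act E m x)"
  by (simp add: free_act_def)

lemma free_act_zero [simp]: "free_act E 0 x = 0" "free_act E a 0 = 0"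
  by (simp_all add: free_act_def lin_ext_def smul_laws)

lemma free_act_right_add: "free_act E a (x + y) = free_act E a x + free_act E a y"
  by (simp add: free_act_def word_act_add lin_ext_add_fun)

lemma free_act_right_smul: "free_act E a (smul c x) = smul c (free_act E a x)"
  by (simp add: free_act_def lin_ext_def word_act_smul smul_sum smul_laws mult.commute)

lemma free_act_right_sum: "free_act E a (sum f A) = (\<Sum>i\<in>A. free_act E a (f i))"
  by (induction A rule: infinite_finite_induct) (simp_all add: free_act_right_add)

lemma free_act_mult: "free_act E (a * b) x = free_act E a (free_act E b x)"
proof -
  have 1: "free_act E (Poly_Mapping.single m c * b) x =
      free_act E (Poly_Mapping.single m c) (free_act E b x)" for m c
  proof -
    have "free_act E (Poly_Mapping.single m c * b) x =
        free_act E (Poly_Mapping.single m c *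
          (\<Sum>n\<in>Poly_Mapping.keys b. Poly_Mapping.single n (Poly_Mapping.lookup b n))) x"
      using poly_mapping_expand[of b] by simp
    also have "\<dots> = smul c (word_act E m (free_act E b x))"
      by (simp add: sum_distrib_left free_act_left mult_single word_act_plus free_act_def[of E b]
          lin_ext_def word_act_sum word_act_smul smul_sum smul_laws)
    finally show ?thesis by simp
  qed
  have "free_act E (a * b) x =
      free_act E ((\<Sum>m\<in>Poly_Mapping.keys a. Poly_Mapping.single m (Poly_Mapping.lookup a m)) * b) x"
    using poly_mapping_expand[of a] by simp
  also have "\<dots> = free_act E (\<Sum>m\<in>Poly_Mapping.keys a. Poly_Mapping.single m (Poly_Mapping.lookup a m)) (free_act E b x)"
    by (simp only: sum_distrib_right free_act_left 1)
  also have "\<dots> = free_act E a (free_act E b x)"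
    using poly_mapping_expand[of a] by simp
  finally show ?thesis .
qed

lemma path_mod_add: "x \<in> path_mod E w \<Longrightarrow> y \<in> path_mod E w \<Longrightarrow> x + y \<in> path_mod E w"
  unfolding path_mod_def using keys_add[of x y] by fastforce

lemma path_mod_smul: "x \<in> path_mod E w \<Longrightarrow> smul c x \<in> path_mod E w"
  unfolding path_mod_def using keys_smul[of c x] by fastforce

lemma path_mod_zero [simp]: "0 \<in> path_mod E w"
  by (simp add: path_mod_def)

lemma path_mod_sum: "(\<And>i. i \<in> A \<Longrightarrow> f i \<in> path_mod E w) \<Longrightarrow> sum f A \<in> path_mod E w"
  by (induction A rule: infinite_finite_induct) (simp_all add: path_mod_add)

lemma gen_act_closed:
  assumes "wf_digraph E" "g \<in> gens E" "pre_digraph.awalk E u p w"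
  shows "gen_act E g (u, p) \<in> path_mod E w"
proof -
  interpret wf_digraph E by fact
  show ?thesis
    using assms(2,3)
    by (cases g; cases p) (auto simp: path_mod_def gens_def awalk_Cons_iff)
qed

lemma word_act_closed:
  assumes "wf_digraph E" "set (letters m) \<subseteq> gens E" "x \<in> path_mod E w"
  shows "word_act E m x \<in> path_mod E w"
proof -
  have "foldr (\<lambda>g. lin_ext (gen_act E g)) gs x \<in> path_mod E w" if "set gs \<subseteq> gens E" for gs
    using that
  proof (induction gs)
    case Nil
    then show ?case using assms(3) by simp
  next
    case (Cons g gs)
    let ?y = "foldr (\<lambda>g. lin_ext (gen_act E g)) gs x"
    have "?y \<in> path_mod E w" using Cons by simp
    then have "case q of (u, p) \<Rightarrow> pre_digraph.awalk E u p w" if "q \<in> Poly_Mapping.keys ?y" for q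
      using that unfolding path_mod_def by blast
    then have "gen_act E g q \<in> path_mod E w" if "q \<in> Poly_Mapping.keys ?y" for q
      using that Cons.prems gen_act_closed[OF assms(1)] by (cases q) force
    then have "lin_ext (gen_act E g) ?y \<in> path_mod E w"
      unfolding lin_ext_def by (intro path_mod_sum path_mod_smul)
    then show ?case by simp
  qed
  with assms(2) show ?thesis by (simp add: word_act_def)
qed

lemma free_act_closed:
  assumes "wf_digraph E" "a \<in> carrier (free_alg (gens E))" "x \<in> path_mod E w"
  shows "free_act E a x \<in> path_mod E w"
  unfolding free_act_def lin_ext_def using assms
  by (intro path_mod_sum path_mod_smul word_act_closed) (auto simp: free_alg_def)

lemma free_alg_closed:
  assumes "a \<in> carrier (free_alg X)" "b \<in> carrier (free_alg X)"
  shows "a + b \<in> carrier (free_alg X)" "a - b \<in> carrier (free_alg X)"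
    "a * b \<in> carrier (free_alg X)"
proof -
  have *: "a \<in> carrier (free_alg X) \<longleftrightarrow> Poly_Mapping.keys a \<subseteq> {m. letters m \<noteq> [] \<and> set (letters m) \<subseteq> X}"
    for a :: "'a word \<Rightarrow>\<^sub>0 'b"
    by (auto simp: free_alg_def)
  show "a + b \<in> carrier (free_alg X)"
    using assms keys_add[of a b] unfolding * by blast
  have "Poly_Mapping.keys (a - b) \<subseteq> Poly_Mapping.keys a \<union> Poly_Mapping.keys b"
    by (auto simp: in_keys_iff lookup_minus)
  then show "a - b \<in> carrier (free_alg X)"
    using assms unfolding * by blast
  show "a * b \<in> carrier (free_alg X)"
    using assms keys_mult[of a b] unfolding * by (fastforce simp: plus_word_def)
qed

lemma free_alg_smul: "a \<in> carrier (free_alg X) \<Longrightarrow> smul c a \<in> carrier (free_alg X)"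
  using keys_smul[of c a] by (auto simp: free_alg_def)

lemma free_alg_zero: "0 \<in> carrier (free_alg X)"
  by (simp add: free_alg_def)

lemma free_alg_sum:
  "(\<And>i. i \<in> A \<Longrightarrow> f i \<in> carrier (free_alg X)) \<Longrightarrow> sum f A \<in> carrier (free_alg X)"
  by (induction A rule: infinite_finite_induct) (simp_all add: free_alg_zero free_alg_closed)

lemma letter_closed: "g \<in> X \<Longrightarrow> letter g \<in> carrier (free_alg X)"
  by (simp add: free_alg_def)

lemma lpa_rels_closed:
  assumes "wf_digraph E"
  shows "lpa_rels E \<subseteq> carrier (free_alg (gens E))"
proof -
  interpret wf_digraph E by fact
  show ?thesis
    unfolding lpa_rels_def regular_def
    by (auto simp: gens_def out_arcs_def intro!: free_alg_closed free_alg_sum letter_closed)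
qed

lemma carrier_ideal: "alg_ideal (free_alg X) (carrier (free_alg X :: ('k::field, 'b word \<Rightarrow>\<^sub>0 'k) alg))"
proof -
  have sel: "azero (free_alg X) = 0" "aplus (free_alg X) = (+)" "atimes (free_alg X) = (*)"
    "ascale (free_alg X) = smul" for X :: "'b set"
    by (simp_all add: free_alg_def)
  show ?thesis
    unfolding alg_ideal_def sel by (simp add: free_alg_closed free_alg_smul free_alg_zero)
qed

lemma free_act_letter: "free_act E (letter g) x = lin_ext (gen_act E g) x"
  by (simp add: word_act_def smul_laws)

lemma lpa_rels_annihilate_path:
  fixes r :: "('v, 'e, 'k::field) lpa_free"
  assumes "wf_digraph E" "sink E w" "r \<in> lpa_rels E" "pre_digraph.awalk E u p w"
  shows "free_act E r (Poly_Mapping.single (u, p) 1) = 0"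
proof -
  interpret wf_digraph E by fact
  have CK2: "(\<Sum>e\<in>out_arcs E v. lin_ext (gen_act E (Ed e)) (gen_act E (Gh e) (u, p))) =
      (gen_act E (Vx v) (u, p) :: ('v, 'e, 'k) path_vec)" if v: "regular E v" for v
  proof (cases p)
    case Nil
    then have "v \<noteq> u" using v assms by (auto simp: sink_def regular_def awalk_Nil_iff)
    then show ?thesis by (simp add: Nil)
  next
    case (Cons f q)
    then have f: "f \<in> arcs E" "tail E f = u" using assms(4) by (auto simp: awalk_Cons_iff)
    have "(\<Sum>e\<in>out_arcs E v. lin_ext (gen_act E (Ed e)) (gen_act E (Gh e) (u, p))) =
        (\<Sum>e\<in>out_arcs E v. if e = f then Poly_Mapping.single (u, p) 1
           else (0 :: ('v, 'e, 'k) path_vec))"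
      by (intro sum.cong refl) (use f Cons in \<open>auto simp: smul_laws\<close>)
    also have "\<dots> = gen_act E (Vx v) (u, p)"
      using v f by (auto simp: regular_def sum.delta in_out_arcs_conv)
    finally show ?thesis .
  qed
  show ?thesis
    using assms(3,4) CK2 unfolding lpa_rels_def
    by (cases p)
      (auto simp: free_act_left free_act_mult free_act_letter smul_laws awalk_Cons_iff
        simp del: free_act_single)
qed

lemma lpa_rels_annihilate:
  assumes "wf_digraph E" "sink E w" "r \<in> lpa_rels E" "x \<in> path_mod E w"
  shows "free_act E r x = 0"
proof -
  have "free_act E r x =
      free_act E r (\<Sum>q\<in>Poly_Mapping.keys x. smul (Poly_Mapping.lookup x q) (Poly_Mapping.single q 1))"
    using poly_mapping_expand[of x] by simp
  also have "\<dots> = 0"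
    unfolding free_act_right_sum free_act_right_smul using assms
    by (intro sum.neutral) (auto simp: lpa_rels_annihilate_path smul_laws path_mod_def)
  finally show ?thesis .
qed

lemma rel_ideal_annihilates:
  fixes E :: "('v, 'e) pre_digraph" and j :: "('v, 'e, 'k::field) lpa_free"
  assumes "wf_digraph E" "sink E w" "j \<in> lpa_rel_ideal E" "x \<in> path_mod E w"
  shows "free_act E j x = 0"
proof -
  let ?F = "free_alg (gens E) :: ('k, ('v, 'e, 'k) lpa_free) alg"
  let ?I = "{a \<in> carrier ?F. \<forall>x\<in>path_mod E w. free_act E a x = 0}"
  have sel: "azero ?F = 0" "aplus ?F = (+)" "atimes ?F = (*)" "ascale ?F = smul"
    by (simp_all add: free_alg_def)
  have "alg_ideal ?F ?I"
    unfolding alg_ideal_def sel using assms(1)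
    by (simp add: free_act_left free_act_mult free_act_closed smul_laws
        free_alg_closed free_alg_smul free_alg_zero)
  moreover have "lpa_rels E \<subseteq> ?I"
    using lpa_rels_closed[OF assms(1)] lpa_rels_annihilate[OF assms(1,2)] by auto
  ultimately have "lpa_rel_ideal E \<subseteq> ?I"
    unfolding lpa_rel_ideal_def ideal_gen_def by (intro Inter_lower) simp
  with assms(3,4) show ?thesis by blast
qed

lemma ideal_gen_ideal:
  assumes "alg_ideal A (carrier A)" "S \<subseteq> carrier A"
  shows "alg_ideal A (ideal_gen A S)"
proof -
  have "ideal_gen A S \<subseteq> carrier A"
    unfolding ideal_gen_def using assms by (intro Inter_lower) simp
  moreover have "azero A \<in> ideal_gen A S"
    by (simp add: alg_ideal_def ideal_gen_def)
  moreover have "aplus A a b \<in> ideal_gen A S" if "a \<in> ideal_gen A S" "b \<in> ideal_gen A S" for a b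
    using that by (simp add: alg_ideal_def ideal_gen_def)
  moreover have "ascale A c a \<in> ideal_gen A S" if "a \<in> ideal_gen A S" for a c
    using that by (simp add: alg_ideal_def ideal_gen_def)
  moreover have "atimes A a b \<in> ideal_gen A S" "atimes A b a \<in> ideal_gen A S"
    if "a \<in> ideal_gen A S" "b \<in> carrier A" for a b
    using that by (simp_all add: alg_ideal_def ideal_gen_def)
  ultimately show ?thesis unfolding alg_ideal_def by simp
qed

lemma lpa_rel_ideal_ideal:
  assumes "wf_digraph E"
  shows "alg_ideal (free_alg (gens E)) (lpa_rel_ideal E)"
  unfolding lpa_rel_ideal_def
  by (rule ideal_gen_ideal[OF carrier_ideal lpa_rels_closed[OF assms]])

lemma lpa_rel_ideal_zero: "0 \<in> lpa_rel_ideal E"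
  by (simp add: lpa_rel_ideal_def ideal_gen_def alg_ideal_def free_alg_def)

lemma lpa_rel_ideal_closed:
  fixes i :: "('v, 'e, 'k::field) lpa_free"
  assumes "wf_digraph E" "i \<in> lpa_rel_ideal E"
  shows "j \<in> lpa_rel_ideal E \<Longrightarrow> i + j \<in> lpa_rel_ideal E" "smul c i \<in> lpa_rel_ideal E"
    "- i \<in> lpa_rel_ideal E" "i \<in> carrier (free_alg (gens E))"
    "a \<in> carrier (free_alg (gens E)) \<Longrightarrow> i * a \<in> lpa_rel_ideal E"
    "a \<in> carrier (free_alg (gens E)) \<Longrightarrow> a * i \<in> lpa_rel_ideal E"
proof -
  note I = lpa_rel_ideal_ideal[where 'c = 'k, OF assms(1), unfolded alg_ideal_def]
  show "j \<in> lpa_rel_ideal E \<Longrightarrow> i + j \<in> lpa_rel_ideal E"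
    using I assms(2) by (simp add: free_alg_def)
  show *: "smul c i \<in> lpa_rel_ideal E" for c
    using I assms(2) by (simp add: free_alg_def)
  have "smul (- 1) i = - i" by (rule poly_mapping_eqI) simp
  with *[of "- 1"] show "- i \<in> lpa_rel_ideal E" by simp
  show "i \<in> carrier (free_alg (gens E))" using I assms(2) by blast
  show "a \<in> carrier (free_alg (gens E)) \<Longrightarrow> i * a \<in> lpa_rel_ideal E"
    "a \<in> carrier (free_alg (gens E)) \<Longrightarrow> a * i \<in> lpa_rel_ideal E"
    using I assms(2) by (simp_all add: free_alg_def)
qed

lemma in_lpa_class_iff: "b \<in> lpa_class E a \<longleftrightarrow> b - a \<in> lpa_rel_ideal E"
proof
  assume "b - a \<in> lpa_rel_ideal E"
  then have "a + (b - a) \<in> (+) a ` lpa_rel_ideal E" by (rule imageI)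
  then show "b \<in> lpa_class E a" by (simp add: lpa_class_def coset_def free_alg_def)
qed (auto simp: lpa_class_def coset_def free_alg_def)

lemma lpa_class_eq_iff:
  assumes "wf_digraph E"
  shows "lpa_class E a = lpa_class E b \<longleftrightarrow> a - b \<in> lpa_rel_ideal E"
proof
  assume "lpa_class E a = lpa_class E b"
  moreover have "a \<in> lpa_class E a" by (simp add: in_lpa_class_iff lpa_rel_ideal_zero)
  ultimately show "a - b \<in> lpa_rel_ideal E" by (simp add: in_lpa_class_iff)
next
  assume *: "a - b \<in> lpa_rel_ideal E"
  have "c - b \<in> lpa_rel_ideal E" if "c - a \<in> lpa_rel_ideal E" for c
    using lpa_rel_ideal_closed(1)[OF assms that *] by simp
  moreover have "c - a \<in> lpa_rel_ideal E" if "c - b \<in> lpa_rel_ideal E" for c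
    using lpa_rel_ideal_closed(1)[OF assms that lpa_rel_ideal_closed(3)[OF assms *]] by simp
  ultimately show "lpa_class E a = lpa_class E b" by (auto simp: in_lpa_class_iff)
qed

lemma UN_same: "a \<in> A \<Longrightarrow> (\<And>x. x \<in> A \<Longrightarrow> f x = C) \<Longrightarrow> (\<Union>x\<in>A. f x) = C"
  by auto

theorem lpa_ops:
  fixes a b :: "('v, 'e, 'k::field) lpa_free"
  assumes "wf_digraph E" "a \<in> carrier (free_alg (gens E))" "b \<in> carrier (free_alg (gens E))"
  shows "lpa_class E a \<in> carrier (lpa E)"
    "aplus (lpa E) (lpa_class E a) (lpa_class E b) = lpa_class E (a + b)"
    "atimes (lpa E) (lpa_class E a) (lpa_class E b) = lpa_class E (a * b)"
    "ascale (lpa E) c (lpa_class E a) = lpa_class E (smul c a)"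
proof -
  note cl = lpa_rel_ideal_closed[OF assms(1)]
  have self: "x \<in> lpa_class E x" for x :: "('v, 'e, 'k) lpa_free"
    by (simp add: in_lpa_class_iff lpa_rel_ideal_zero)
  have cs: "coset (free_alg (gens E)) (lpa_rel_ideal E) = lpa_class E"
    by (simp add: fun_eq_iff lpa_class_def)
  have sel: "aplus (free_alg X) = (+)" "atimes (free_alg X) = (*)" "ascale (free_alg X) = smul"
    for X :: "('v, 'e) lpa_gen set"
    by (simp_all add: free_alg_def)
  show "lpa_class E a \<in> carrier (lpa E)"
    using assms(2) by (simp add: lpa_def quot_def cs)
  have "lpa_class E (x + y) = lpa_class E (a + b)"
    if "x \<in> lpa_class E a" "y \<in> lpa_class E b" for x y
    using cl(1)[of "x - a" "y - b"] that
    by (simp add: lpa_class_eq_iff[OF assms(1)] in_lpa_class_iff algebra_simps)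
  then have "(\<Union>x\<in>lpa_class E a. \<Union>y\<in>lpa_class E b. lpa_class E (x + y)) = lpa_class E (a + b)"
    by (intro UN_same[OF self])
  then show "aplus (lpa E) (lpa_class E a) (lpa_class E b) = lpa_class E (a + b)"
    by (simp add: lpa_def quot_def cs sel)
  have "lpa_class E (x * y) = lpa_class E (a * b)"
    if x: "x \<in> lpa_class E a" and y: "y \<in> lpa_class E b" for x y
  proof -
    from x y have *: "x - a \<in> lpa_rel_ideal E" "y - b \<in> lpa_rel_ideal E"
      by (simp_all add: in_lpa_class_iff)
    have "y \<in> carrier (free_alg (gens E))"
      using free_alg_closed(1)[OF cl(4)[OF *(2)] assms(3)] by simp
    from cl(1)[OF cl(5)[OF *(1) this] cl(6)[OF *(2) assms(2)]]
    show ?thesis by (simp add: lpa_class_eq_iff[OF assms(1)] algebra_simps)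
  qed
  then have "(\<Union>x\<in>lpa_class E a. \<Union>y\<in>lpa_class E b. lpa_class E (x * y)) = lpa_class E (a * b)"
    by (intro UN_same[OF self])
  then show "atimes (lpa E) (lpa_class E a) (lpa_class E b) = lpa_class E (a * b)"
    by (simp add: lpa_def quot_def cs sel)
  have "lpa_class E (smul c x) = lpa_class E (smul c a)" if "x \<in> lpa_class E a" for x
  proof -
    have "smul c (x - a) = smul c x - smul c a"
      by (rule poly_mapping_eqI) (simp add: lookup_minus algebra_simps)
    then show ?thesis
      using cl(2)[of "x - a" c] that by (simp add: lpa_class_eq_iff[OF assms(1)] in_lpa_class_iff)
  qed
  then have "(\<Union>x\<in>lpa_class E a. lpa_class E (smul c x)) = lpa_class E (smul c a)"
    by (intro UN_same[OF self])
  then show "ascale (lpa E) c (lpa_class E a) = lpa_class E (smul c a)"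
    by (simp add: lpa_def quot_def cs sel)
qed

theorem lpa_act_class:
  assumes "wf_digraph E" "sink E w" "x \<in> path_mod E w"
  shows "lpa_act E (lpa_class E a) x = free_act E a x"
proof -
  have "(\<lambda>b. free_act E b x) ` lpa_class E a = {free_act E a x}"
    using rel_ideal_annihilates[OF assms(1,2) _ assms(3)] lpa_rel_ideal_zero[of E]
    by (auto simp: lpa_class_def coset_def free_alg_def free_act_left image_image
        intro!: image_eqI[of _ _ 0])
  then show ?thesis by (simp add: lpa_act_def)
qed

theorem H_of_hereditary_saturated:
  assumes "wf_digraph E" "sink E w"
  shows "hereditary E (H_of E w)" "saturated E (H_of E w)"
proof -
  interpret wf_digraph E by fact
  show "hereditary E (H_of E w)"
    unfolding hereditary_def H_of_def path_ge_def
  proof (intro conjI ballI allI impI)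
    fix u u' assume u: "u \<in> verts E - {u \<in> verts E. \<exists>p. awalk u p w}" and "\<exists>p. awalk u p u'"
    then obtain p where p: "awalk u p u'" by blast
    have "\<not> awalk u' q w" for q
    proof
      assume "awalk u' q w"
      with p have "awalk u (p @ q) w" by (rule awalk_appendI)
      with u show False by blast
    qed
    then show "u' \<in> verts E - {u \<in> verts E. \<exists>p. awalk u p w}"
      using awalk_last_in_verts[OF p] by simp
  qed simp
  show "saturated E (H_of E w)"
    unfolding saturated_def
  proof (intro allI impI)
    fix u assume u: "regular E u \<and> head E ` out_arcs E u \<subseteq> H_of E w"
    have "\<not> awalk u p w" for p
    proof
      assume p: "awalk u p w"
      show False
      proof (cases p)
        case Nil
        then show False using p u assms(2) by (auto simp: sink_def regular_def awalk_Nil_iff)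
      next
        case (Cons e q)
        then have "e \<in> out_arcs E u" "awalk (head E e) q w"
          using p by (auto simp: awalk_Cons_iff)
        moreover from this have "head E e \<in> H_of E w" using u by blast
        ultimately show False by (auto simp: H_of_def path_ge_def)
      qed
    qed
    then show "u \<in> H_of E w" using u by (auto simp: H_of_def path_ge_def regular_def)
  qed
qed

end

theory Submission
  imports Defs
begin

text \<open>
  Write \<open>H = H(w)\<close> and let \<open>I\<close> be the ideal generated by \<open>H\<close> and by the elements \<open>u\<^sup>H\<close> for the
  breaking vertices \<open>u\<close>. That \<open>I\<close> annihilates \<open>N\<^sub>w\<close> is checked on the generators: no path to \<open>w\<close>
  starts in \<open>H\<close>, and a path to \<open>w\<close> that starts in \<open>u\<close> begins with an arc whose head is outside \<open>H\<close>,
  so that the sum subtracted in \<open>u\<^sup>H\<close> acts on it as \<open>u\<close> does (\<open>lpa_ideal_subset_annihilator\<close>).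

  For the converse one could identify the quotient by \<open>I\<close> with the Leavitt path algebra of the graph
  on the complement of \<open>H\<close>, where every vertex connects to the sink \<open>w\<close>, and apply a uniqueness
  theorem. The proof below stays in the algebra and is elementary. Modulo \<open>I\<close> every
  element is a linear combination of monomials \<open>pq\<^sup>*\<close> with \<open>p\<close>, \<open>q\<close> paths that end at the same vertex
  outside \<open>H\<close> (\<open>closed_reducible\<close>). Let such a combination \<open>a\<close> act as zero. The proof that \<open>a \<in> I\<close> is
  by induction on the maximal length of the ghost paths \<open>q\<close> (\<open>act_zero_imp_in_J\<close>). For an arc \<open>e\<close>,
  \<open>ae\<close> also acts as zero, and its ghost paths are shorter; so \<open>ae \<in> I\<close> as soon as \<open>a\<close> has a ghost path
  of positive length. As \<open>a\<close> is a sum of finitely many \<open>au\<close>, it remains to treat each vertex \<open>u \<notin> H\<close>.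

  \<^item> Suppose that some path \<open>\<gamma>\<close> from \<open>u\<close> to \<open>w\<close> is killed by all ghost paths of positive length in
    \<open>a\<close>, because it has length \<open>0\<close> or its first arc differs from theirs. Then \<open>a\<gamma> = 0\<close> is
    a combination of the distinct paths \<open>p\<gamma>\<close> with the coefficients of the monomials \<open>p\<close> in \<open>a\<close> that
    end in \<open>u\<close>. So these vanish (\<open>real_coefficients_vanish\<close>), all remaining monomials in \<open>au\<close> end
    in a ghost arc, and \<open>au\<close> is congruent to a finite sum of elements \<open>aff\<^sup>*\<close> (\<open>ghost_expansion\<close>).
  \<^item> Otherwise \<open>u \<noteq> w\<close>, and every arc from \<open>u\<close> to the complement of \<open>H\<close> starts a path to \<open>w\<close> and hence
    occurs as the first arc of one of the finitely many ghost paths in \<open>a\<close>. So there are only finitely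
    many such arcs \<open>e\<close>. Modulo \<open>I\<close> the vertex \<open>u\<close> is then the sum of their projections \<open>ee\<^sup>*\<close>, by a
    Leavitt relation if \<open>u\<close> is regular and by \<open>u\<^sup>H \<in> I\<close> if it is breaking (\<open>vx_outside_expansion\<close>).

  In both cases \<open>au\<close> is congruent to a finite sum of elements \<open>aee\<^sup>*\<close> with \<open>ae \<in> I\<close>.
\<close>


section \<open>The ideal annihilates the module\<close>

lemma lpa_carrier: "carrier (lpa E) = lpa_class E ` carrier (free_alg (gens E))"
  by (simp add: lpa_def quot_def lpa_class_def[abs_def])

lemma lpa_zero: "azero (lpa E) = lpa_class E 0"
  by (simp add: lpa_def quot_def lpa_class_def free_alg_def)

lemma lpa_carrier_ideal:
  assumes "wf_digraph E"
  shows "alg_ideal (lpa E :: ('k::field, ('v, 'e, 'k) lpa_elem) alg) (carrier (lpa E))"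
  unfolding alg_ideal_def lpa_carrier lpa_zero
  by (auto simp: lpa_ops[OF assms] free_alg_closed free_alg_smul free_alg_zero)

lemma annihilator_class_iff:
  fixes a :: "('v, 'e, 'k::field) lpa_free"
  assumes "wf_digraph E" "sink E w" "a \<in> carrier (free_alg (gens E))"
  shows "lpa_class E a \<in> annihilator (lpa E) (lpa_act E) (path_mod E w) \<longleftrightarrow>
    (\<forall>x\<in>path_mod E w. free_act E a x = 0)"
  using assms(3)
  by (auto simp: annihilator_def lpa_ops[OF assms(1)] lpa_act_class[OF assms(1,2)])

lemma annihilator_ideal:
  fixes E :: "('v, 'e) pre_digraph"
  assumes "wf_digraph E" "sink E w"
  shows "alg_ideal (lpa E :: ('k::field, ('v, 'e, 'k) lpa_elem) alg)
    (annihilator (lpa E) (lpa_act E) (path_mod E w))" (is "alg_ideal ?L ?A")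
proof -
  have A: "?A = lpa_class E ` {a \<in> carrier (free_alg (gens E)). \<forall>x\<in>path_mod E w. free_act E a x = 0}"
    by (auto simp: annihilator_def lpa_carrier lpa_act_class[OF assms])
  show ?thesis
    unfolding alg_ideal_def lpa_zero A lpa_carrier
    using assms(1)
    by (auto simp: lpa_ops free_alg_closed free_alg_smul free_alg_zero
        free_act_left free_act_mult free_act_closed smul_laws intro!: imageI)
qed

lemma free_act_zeroI:
  assumes "\<And>u p. pre_digraph.awalk E u p w \<Longrightarrow> free_act E a (Poly_Mapping.single (u, p) 1) = 0"
    and "x \<in> path_mod E w"
  shows "free_act E a x = 0"
proof -
  have "free_act E a x =
      free_act E a (\<Sum>q\<in>Poly_Mapping.keys x. smul (Poly_Mapping.lookup x q) (Poly_Mapping.single q 1))"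
    using poly_mapping_expand[of x] by simp
  also have "\<dots> = 0"
    unfolding free_act_right_sum free_act_right_smul using assms
    by (intro sum.neutral) (auto simp: smul_laws path_mod_def)
  finally show ?thesis .
qed

lemma vx_act_zero:
  assumes "v \<in> H_of E w" "x \<in> path_mod E w"
  shows "free_act E (vx v :: ('v, 'e, 'k::field) lpa_free) x = 0"
  using assms(2)
proof (rule free_act_zeroI[rotated])
  fix u p assume "pre_digraph.awalk E u p w"
  then have "u \<noteq> v"
    using assms(1) by (auto simp: H_of_def path_ge_def pre_digraph.awalk_def)
  then show "free_act E (vx v) (Poly_Mapping.single (u, p) 1) = (0 :: ('v, 'e, 'k) path_vec)"
    by (simp add: free_act_letter smul_laws del: free_act_single)
qed

text \<open>
  On a path that starts in \<open>u\<close>, each projection \<open>ee\<^sup>*\<close> is the indicator of \<open>e\<close> being the first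
  arc. A path to \<open>w\<close> that starts in a breaking vertex \<open>u\<close> has a first arc, and that arc cannot lead
  into \<open>H(w)\<close>; so the sum in \<open>u\<^sup>H\<close> acts on it as the identity.
\<close>

lemma gap_act_zero:
  assumes "wf_digraph E" "sink E w" "v \<in> breaking E (H_of E w)" "x \<in> path_mod E w"
  shows "free_act E (gap E (H_of E w) v :: ('v, 'e, 'k::field) lpa_free) x = 0"
  using assms(4)
proof (rule free_act_zeroI[rotated])
  interpret wf_digraph E by fact
  fix u p assume p: "awalk u p w"
  let ?O = "arcs_outside E (H_of E w) v"
  have fin: "finite ?O" and inf: "infinite (out_arcs E v)"
    using assms(3) by (auto simp: breaking_def infinite_emitter_def)
  have "(\<Sum>e\<in>?O. lin_ext (gen_act E (Ed e)) (gen_act E (Gh e) (u, p))) =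
      (gen_act E (Vx v) (u, p) :: ('v, 'e, 'k) path_vec)"
  proof (cases p)
    case Nil
    then have "v \<noteq> u" using p inf assms(2) by (auto simp: sink_def awalk_Nil_iff)
    then show ?thesis by (simp add: Nil)
  next
    case (Cons f q)
    then have f: "f \<in> arcs E" "tail E f = u" "awalk (head E f) q w"
      using p by (auto simp: awalk_Cons_iff)
    then have "f \<in> ?O \<longleftrightarrow> v = u"
      by (auto simp: arcs_outside_def H_of_def path_ge_def)
    then have "gen_act E (Vx v) (u, p) =
        (\<Sum>e\<in>?O. if e = f then Poly_Mapping.single (u, p) 1 else (0 :: ('v, 'e, 'k) path_vec))"
      using fin by (simp add: sum.delta)
    also have "\<dots> = (\<Sum>e\<in>?O. lin_ext (gen_act E (Ed e)) (gen_act E (Gh e) (u, p)))"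
      by (intro sum.cong refl) (use f Cons in \<open>auto simp: smul_laws\<close>)
    finally show ?thesis by simp
  qed
  then show "free_act E (gap E (H_of E w) v) (Poly_Mapping.single (u, p) 1) =
      (0 :: ('v, 'e, 'k) path_vec)"
    by (simp add: gap_def free_act_left free_act_mult free_act_letter smul_laws
        del: free_act_single)
qed

lemma gap_closed:
  fixes E :: "('v, 'e) pre_digraph"
  assumes "u \<in> verts E"
  shows "(gap E H u :: ('v, 'e, 'k::field) lpa_free) \<in> carrier (free_alg (gens E))"
  using assms
  by (auto simp: gap_def arcs_outside_def gens_def
      intro!: free_alg_closed free_alg_sum letter_closed)

lemma lpa_ideal_subset_annihilator:
  fixes E :: "('v, 'e) pre_digraph"
  assumes "wf_digraph E" "sink E w"
  shows "(lpa_ideal E (H_of E w) (breaking E (H_of E w)) :: ('v, 'e, 'k::field) lpa_elem set) \<subseteq>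
    annihilator (lpa E) (lpa_act E) (path_mod E w)"
  unfolding lpa_ideal_def ideal_gen_def
proof (intro Inter_lower CollectI conjI Un_least image_subsetI)
  show "alg_ideal (lpa E) (annihilator (lpa E) (lpa_act E) (path_mod E w))"
    by (rule annihilator_ideal[OF assms])
next
  fix v assume v: "v \<in> H_of E w"
  then have "(vx v :: ('v, 'e, 'k) lpa_free) \<in> carrier (free_alg (gens E))"
    by (intro letter_closed) (auto simp: H_of_def gens_def)
  then show "lpa_class E (vx v :: ('v, 'e, 'k) lpa_free) \<in>
      annihilator (lpa E) (lpa_act E) (path_mod E w)"
    by (simp add: annihilator_class_iff[OF assms] vx_act_zero[OF v] del: free_act_single)
next
  fix u assume u: "u \<in> breaking E (H_of E w)"
  then have "(gap E (H_of E w) u :: ('v, 'e, 'k) lpa_free) \<in> carrier (free_alg (gens E))"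
    by (intro gap_closed) (auto simp: breaking_def)
  then show "lpa_class E (gap E (H_of E w) u :: ('v, 'e, 'k) lpa_free) \<in>
      annihilator (lpa E) (lpa_act E) (path_mod E w)"
    by (simp add: annihilator_class_iff[OF assms] gap_act_zero[OF assms u])
qed


section \<open>Congruence modulo an ideal that contains the relations\<close>

text \<open>The vertex that is a right unit for the generator.\<close>

primrec right_end :: "('v, 'e) pre_digraph \<Rightarrow> ('v, 'e) lpa_gen \<Rightarrow> 'v" where
  "right_end E (Vx v) = v"
| "right_end E (Ed e) = head E e"
| "right_end E (Gh e) = tail E e"

abbreviation monom :: "'g list \<Rightarrow> ('g word \<Rightarrow>\<^sub>0 'k::field)" where
  "monom ms \<equiv> Poly_Mapping.single (Word ms) 1"

lemma monom_append: "monom (ms @ ns) = monom ms * monom ns"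
  by (simp add: mult_single plus_word_def)

lemma monom_closed:
  assumes "ms \<noteq> []" "set ms \<subseteq> X"
  shows "monom ms \<in> carrier (free_alg X)"
  using assms by (simp add: free_alg_def)

lemma smul_mult: "smul c (x :: 'g word \<Rightarrow>\<^sub>0 'k::field) * y = smul c (x * y)"
proof -
  have *: "smul c x = Poly_Mapping.single 0 c * x" for x :: "'g word \<Rightarrow>\<^sub>0 'k"
  proof -
    have "Poly_Mapping.single 0 c * x = (\<Sum>q\<in>Poly_Mapping.keys x.
        Poly_Mapping.single 0 c * Poly_Mapping.single q (Poly_Mapping.lookup x q))"
      by (subst (1) poly_mapping_expand[of x]) (simp add: sum_distrib_left)
    also have "\<dots> = smul c (\<Sum>q\<in>Poly_Mapping.keys x. Poly_Mapping.single q (Poly_Mapping.lookup x q))"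
      by (simp add: mult_single smul_sum)
    finally show ?thesis by (simp flip: poly_mapping_expand)
  qed
  show ?thesis unfolding * by (rule mult.assoc)
qed

text \<open>
  The intended \<open>J\<close> is the preimage of \<open>I\<close> in the free algebra. There an element is a finitely
  supported function on words, so that a combination of monomials has well-defined coefficients,
  and computation in the quotient becomes a congruence.
\<close>

locale annihilating_ideal = wf_digraph E for E :: "('v, 'e) pre_digraph" +
  fixes w :: 'v and J :: "('v, 'e, 'k::field) lpa_free set"
  assumes ideal: "alg_ideal (free_alg (gens E)) J"
    and rels: "lpa_rels E \<subseteq> J"
    and vertices: "v \<in> H_of E w \<Longrightarrow> vx v \<in> J"
    and gaps: "u \<in> breaking E (H_of E w) \<Longrightarrow> gap E (H_of E w) u \<in> J"
    and annihilates: "j \<in> J \<Longrightarrow> x \<in> path_mod E w \<Longrightarrow> free_act E j x = 0"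
begin

abbreviation C :: "('v, 'e, 'k) lpa_free set" where
  "C \<equiv> carrier (free_alg (gens E))"

definition eqv :: "('v, 'e, 'k) lpa_free \<Rightarrow> ('v, 'e, 'k) lpa_free \<Rightarrow> bool" (infix "\<approx>" 50) where
  "a \<approx> b \<longleftrightarrow> a - b \<in> J"

lemma J_zero: "0 \<in> J"
  and J_add: "a \<in> J \<Longrightarrow> b \<in> J \<Longrightarrow> a + b \<in> J"
  and J_smul: "a \<in> J \<Longrightarrow> smul c a \<in> J"
  and J_right: "a \<in> J \<Longrightarrow> b \<in> C \<Longrightarrow> a * b \<in> J"
  and J_left: "a \<in> J \<Longrightarrow> b \<in> C \<Longrightarrow> b * a \<in> J"
  using ideal by (simp_all add: alg_ideal_def free_alg_def)

lemma J_minus: "a \<in> J \<Longrightarrow> - a \<in> J"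
proof -
  assume "a \<in> J"
  moreover have "smul (- 1) a = - a" by (rule poly_mapping_eqI) simp
  ultimately show ?thesis using J_smul[of a "- 1"] by simp
qed

lemma J_sum: "(\<And>i. i \<in> A \<Longrightarrow> f i \<in> J) \<Longrightarrow> sum f A \<in> J"
  by (induction A rule: infinite_finite_induct) (auto simp: J_zero J_add)

lemma eqv_zero_iff: "a \<approx> 0 \<longleftrightarrow> a \<in> J"
  by (simp add: eqv_def)

lemma eqv_refl [simp]: "a \<approx> a"
  by (simp add: eqv_def J_zero)

lemma eqv_sym: "a \<approx> b \<Longrightarrow> b \<approx> a"
  unfolding eqv_def using J_minus[of "a - b"] by simp

lemma eqv_trans [trans]: "a \<approx> b \<Longrightarrow> b \<approx> c \<Longrightarrow> a \<approx> c"
  unfolding eqv_def using J_add[of "a - b" "b - c"] by simp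

lemma eqv_J: "a \<approx> b \<Longrightarrow> b \<in> J \<Longrightarrow> a \<in> J"
  unfolding eqv_def using J_add[of "a - b" b] by simp

lemma eqv_add: "a \<approx> b \<Longrightarrow> c \<approx> d \<Longrightarrow> a + c \<approx> b + d"
  unfolding eqv_def using J_add[of "a - b" "c - d"] by (simp add: algebra_simps)

lemma eqv_sum: "(\<And>i. i \<in> A \<Longrightarrow> f i \<approx> g i) \<Longrightarrow> sum f A \<approx> sum g A"
  unfolding eqv_def by (simp add: J_sum flip: sum_subtractf)

lemma eqv_smul: "a \<approx> b \<Longrightarrow> smul c a \<approx> smul c b"
proof -
  have "smul c (a - b) = smul c a - smul c b"
    by (rule poly_mapping_eqI) (simp add: lookup_minus algebra_simps)
  then show "a \<approx> b \<Longrightarrow> smul c a \<approx> smul c b"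
    unfolding eqv_def using J_smul[of "a - b" c] by simp
qed

lemma eqv_right: "a \<approx> b \<Longrightarrow> c \<in> C \<Longrightarrow> a * c \<approx> b * c"
  unfolding eqv_def using J_right[of "a - b" c] by (simp add: algebra_simps)

text \<open>The empty word is not in the free algebra, but it does no harm as a prefix.\<close>

lemma eqv_left: "a \<approx> b \<Longrightarrow> set ms \<subseteq> gens E \<Longrightarrow> monom ms * a \<approx> monom ms * b"
proof (cases ms)
  case Nil
  then have "monom ms = (1 :: ('v, 'e, 'k) lpa_free)" by (simp flip: zero_word_def)
  then show "a \<approx> b \<Longrightarrow> monom ms * a \<approx> monom ms * b" by simp
next
  case (Cons m ns)
  assume "a \<approx> b" "set ms \<subseteq> gens E"
  then show ?thesis
    unfolding eqv_def
    using J_left[of "a - b" "monom ms"] monom_closed[of ms "gens E"] Cons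
    by (simp add: algebra_simps)
qed

lemma vx_C [simp]: "v \<in> verts E \<Longrightarrow> vx v \<in> C"
  and ed_C [simp]: "e \<in> arcs E \<Longrightarrow> ed e \<in> C"
  and gh_C [simp]: "e \<in> arcs E \<Longrightarrow> gh e \<in> C"
  by (auto intro!: letter_closed simp: gens_def)

lemma rel_vx_vx: "v \<in> verts E \<Longrightarrow> vx v * vx v \<approx> vx v"
  and rel_vx_vx': "u \<in> verts E \<Longrightarrow> v \<in> verts E \<Longrightarrow> u \<noteq> v \<Longrightarrow> vx u * vx v \<approx> 0"
  and rel_vx_ed: "e \<in> arcs E \<Longrightarrow> vx (tail E e) * ed e \<approx> ed e"
  and rel_ed_vx: "e \<in> arcs E \<Longrightarrow> ed e * vx (head E e) \<approx> ed e"
  and rel_vx_gh: "e \<in> arcs E \<Longrightarrow> vx (head E e) * gh e \<approx> gh e"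
  and rel_gh_vx: "e \<in> arcs E \<Longrightarrow> gh e * vx (tail E e) \<approx> gh e"
  and rel_gh_ed: "e \<in> arcs E \<Longrightarrow> gh e * ed e \<approx> vx (head E e)"
  and rel_gh_ed': "e \<in> arcs E \<Longrightarrow> f \<in> arcs E \<Longrightarrow> e \<noteq> f \<Longrightarrow> gh e * ed f \<approx> 0"
  and rel_regular: "regular E v \<Longrightarrow> vx v \<approx> (\<Sum>e\<in>out_arcs E v. ed e * gh e)"
  unfolding eqv_def diff_zero
  by (rule subsetD[OF rels], unfold lpa_rels_def, blast)+

lemma right_end_vert: "g \<in> gens E \<Longrightarrow> right_end E g \<in> verts E"
  by (auto simp: gens_def)

lemma letter_vx:
  assumes "g \<in> gens E" "u \<in> verts E"
  shows "letter g * vx u \<approx> (if u = right_end E g then letter g else 0)"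
proof -
  have unit: "letter g * vx (right_end E g) \<approx> letter g"
    using assms(1) rel_vx_vx rel_ed_vx rel_gh_vx by (cases g) (auto simp: gens_def)
  show ?thesis
  proof (cases "u = right_end E g")
    case False
    have "letter g * vx u \<approx> letter g * vx (right_end E g) * vx u"
      by (rule eqv_sym, rule eqv_right[OF unit]) (use assms in simp)
    also have "\<dots> = letter g * (vx (right_end E g) * vx u)" by (rule mult.assoc)
    also have "\<dots> \<approx> letter g * 0"
      using assms False right_end_vert by (intro eqv_left rel_vx_vx') auto
    finally show ?thesis using False by simp
  qed (use unit in simp)
qed

lemma monom_vx:
  assumes "ms \<noteq> []" "set ms \<subseteq> gens E" "u \<in> verts E"
  shows "monom ms * vx u \<approx> (if u = right_end E (last ms) then monom ms else 0)"
proof -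
  have ms: "ms = butlast ms @ [last ms]" using assms(1) by simp
  have g: "last ms \<in> gens E" using assms last_in_set by blast
  have "monom ms * vx u = monom (butlast ms) * (letter (last ms) * vx u)"
    by (subst (1) ms) (simp only: monom_append mult.assoc)
  also have "\<dots> \<approx> monom (butlast ms) * (if u = right_end E (last ms) then letter (last ms) else 0)"
    using assms by (intro eqv_left letter_vx g) (auto dest: in_set_butlastD)
  also have "\<dots> = (if u = right_end E (last ms) then monom ms else 0)"
    using ms by (simp flip: monom_append del: append_butlast_last_id)
  finally show ?thesis .
qed

lemma monom_other_ed:
  assumes "ms \<noteq> []" "set ms \<subseteq> gens E" "e \<in> arcs E" "right_end E (last ms) \<noteq> tail E e"
  shows "monom ms * ed e \<in> J"
proof -
  have "monom ms * ed e \<approx> monom ms * (vx (tail E e) * ed e)"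
    using assms by (intro eqv_left eqv_sym[OF rel_vx_ed]) auto
  also have "\<dots> = monom ms * vx (tail E e) * ed e" by (simp only: mult.assoc)
  also have "\<dots> \<approx> 0 * ed e"
    using monom_vx[OF assms(1,2), of "tail E e"] assms by (intro eqv_right) auto
  finally show ?thesis by (simp add: eqv_zero_iff)
qed

lemma monom_other_gh:
  assumes "ms \<noteq> []" "set ms \<subseteq> gens E" "e \<in> arcs E" "right_end E (last ms) \<noteq> head E e"
  shows "monom ms * gh e \<in> J"
proof -
  have "monom ms * gh e \<approx> monom ms * (vx (head E e) * gh e)"
    using assms by (intro eqv_left eqv_sym[OF rel_vx_gh]) auto
  also have "\<dots> = monom ms * vx (head E e) * gh e" by (simp only: mult.assoc)
  also have "\<dots> \<approx> 0 * gh e"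
    using monom_vx[OF assms(1,2), of "head E e"] assms by (intro eqv_right) auto
  finally show ?thesis by (simp add: eqv_zero_iff)
qed

lemma ed_into_H: "e \<in> arcs E \<Longrightarrow> head E e \<in> H_of E w \<Longrightarrow> ed e \<in> J"
  using eqv_J[OF eqv_sym[OF rel_ed_vx]] J_left[OF vertices] by simp

text \<open>
  Modulo \<open>J\<close> the arcs into \<open>H(w)\<close> vanish. So a vertex that emits finitely many arcs to the
  complement of \<open>H(w)\<close> satisfies the last Leavitt relation of the graph without \<open>H(w)\<close>: a regular
  one because it did so before, a breaking one because its gap lies in \<open>J\<close>.
\<close>

lemma vx_outside_expansion:
  assumes u: "u \<in> verts E" "u \<notin> H_of E w" "u \<noteq> w"
    and fin: "finite (arcs_outside E (H_of E w) u)"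
  shows "vx u \<approx> (\<Sum>e\<in>arcs_outside E (H_of E w) u. ed e * gh e)"
proof -
  let ?O = "arcs_outside E (H_of E w) u"
  obtain p where p: "awalk u p w" using u by (auto simp: H_of_def path_ge_def)
  then obtain e q where "p = e # q" using u by (cases p) (auto simp: awalk_Nil_iff)
  with p have e: "e \<in> ?O"
    by (auto simp: awalk_Cons_iff arcs_outside_def H_of_def path_ge_def)
  show ?thesis
  proof (cases "finite (out_arcs E u)")
    case True
    have sub: "?O \<subseteq> out_arcs E u" by (auto simp: arcs_outside_def)
    have "vx u \<approx> (\<Sum>e\<in>out_arcs E u. ed e * gh e)"
      by (rule rel_regular) (use u True e sub in \<open>auto simp: regular_def\<close>)
    also have "\<dots> = (\<Sum>e\<in>out_arcs E u - ?O. ed e * gh e) + (\<Sum>e\<in>?O. ed e * gh e)"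
      by (rule sum.subset_diff[OF sub True])
    also have "\<dots> \<approx> 0 + (\<Sum>e\<in>?O. ed e * gh e)"
      by (intro eqv_add eqv_refl, unfold eqv_zero_iff, intro J_sum J_right ed_into_H)
        (auto simp: arcs_outside_def)
    finally show ?thesis by simp
  next
    case False
    have "0 < card ?O" using e fin by (auto simp: card_gt_0_iff)
    then have "u \<in> breaking E (H_of E w)"
      using u fin False by (auto simp: breaking_def infinite_emitter_def)
    then show ?thesis using gaps unfolding eqv_def gap_def by blast
  qed
qed


section \<open>The monomials \<open>pq\<^sup>*\<close>\<close>

text \<open>
  The monomial \<open>pq\<^sup>*\<close> for two paths \<open>p\<close>, \<open>q\<close> that end in \<open>v\<close>. With the vertex \<open>v\<close> in the middle
  the word is non-empty also when both paths have length \<open>0\<close>.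
\<close>

definition path_pair :: "'e list \<Rightarrow> 'v \<Rightarrow> 'e list \<Rightarrow> ('v, 'e) lpa_gen list" where
  "path_pair p v q = map Ed p @ Vx v # map Gh (rev q)"

text \<open>The bound on the ghost paths is the parameter of the main induction.\<close>

definition path_pairs :: "nat \<Rightarrow> ('v, 'e) lpa_gen word set" where
  "path_pairs n = {Word (path_pair p v q) | p v q. v \<notin> H_of E w \<and>
     (\<exists>x. awalk x p v) \<and> (\<exists>u. awalk u q v) \<and> length q \<le> n}"

definition reducible :: "nat \<Rightarrow> ('v, 'e, 'k) lpa_free \<Rightarrow> bool" where
  "reducible n a \<longleftrightarrow> (\<exists>b. Poly_Mapping.keys b \<subseteq> path_pairs n \<and> a \<approx> b)"

lemma path_pairE:
  assumes "m \<in> path_pairs n"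
  obtains p v q x u where "m = Word (path_pair p v q)" "v \<notin> H_of E w" "awalk x p v" "awalk u q v"
    "length q \<le> n"
  using assms unfolding path_pairs_def by blast

lemma path_pairI:
  "v \<notin> H_of E w \<Longrightarrow> awalk x p v \<Longrightarrow> awalk u q v \<Longrightarrow> length q \<le> n \<Longrightarrow>
    Word (path_pair p v q) \<in> path_pairs n"
  unfolding path_pairs_def by blast

lemma path_pairs_mono: "n \<le> n' \<Longrightarrow> path_pairs n \<subseteq> path_pairs n'"
  unfolding path_pairs_def by force

lemma path_pair_ghost: "path_pair p v (f # q) = path_pair p v q @ [Gh f]"
  by (simp add: path_pair_def)

lemma path_pair_nonempty [simp]: "path_pair p v q \<noteq> []"
  by (simp add: path_pair_def)

lemma path_pair_gens:
  assumes "awalk x p v" "awalk u q v"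
  shows "set (path_pair p v q) \<subseteq> gens E"
  using assms awalk_last_in_verts[OF assms(1)] by (auto simp: path_pair_def gens_def awalk_def)

lemma right_end_path_pair:
  assumes "awalk u q v"
  shows "right_end E (last (path_pair p v q)) = u"
  using assms by (cases q) (auto simp: path_pair_def awalk_simps)

lemma path_pairs_gens:
  assumes "Word ms \<in> path_pairs n"
  shows "ms \<noteq> []" "set ms \<subseteq> gens E"
  using assms by (auto elim!: path_pairE dest: subsetD[OF path_pair_gens])

lemma lin_path_pairs_C:
  assumes "Poly_Mapping.keys a \<subseteq> path_pairs n"
  shows "a \<in> C"
proof -
  have "letters m \<noteq> [] \<and> set (letters m) \<subseteq> gens E" if "m \<in> Poly_Mapping.keys a" for m
    using that assms path_pairs_gens[of "letters m" n] by auto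
  then show ?thesis by (simp add: free_alg_def)
qed

lemma reducible_eqv: "a \<approx> b \<Longrightarrow> reducible n b \<Longrightarrow> reducible n a"
  unfolding reducible_def using eqv_trans by blast

lemma reducible_J: "a \<in> J \<Longrightarrow> reducible n a"
  unfolding reducible_def by (intro exI[of _ 0]) (simp add: eqv_zero_iff)

lemma reducible_monom: "Word ms \<in> path_pairs n \<Longrightarrow> reducible n (monom ms)"
  unfolding reducible_def by (intro exI[of _ "monom ms"]) simp

lemma reducible_add: "reducible n a \<Longrightarrow> reducible n b \<Longrightarrow> reducible n (a + b)"
  unfolding reducible_def using eqv_add keys_add by (meson Un_least order_trans)

lemma reducible_smul: "reducible n a \<Longrightarrow> reducible n (smul c a)"
  unfolding reducible_def using eqv_smul keys_smul by (meson order_trans)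

lemma reducible_sum: "(\<And>i. i \<in> A \<Longrightarrow> reducible n (f i)) \<Longrightarrow> reducible n (sum f A)"
  by (induction A rule: infinite_finite_induct) (auto simp: reducible_add reducible_J J_zero)

lemma reducible_mono: "n \<le> n' \<Longrightarrow> reducible n a \<Longrightarrow> reducible n' a"
  unfolding reducible_def using path_pairs_mono by blast

lemma mult_expand:
  fixes a b :: "('v, 'e, 'k) lpa_free"
  shows "a * b = (\<Sum>m\<in>Poly_Mapping.keys a. smul (Poly_Mapping.lookup a m) (monom (letters m) * b))"
proof -
  have "a * b = (\<Sum>m\<in>Poly_Mapping.keys a. smul (Poly_Mapping.lookup a m) (monom (letters m))) * b"
    using poly_mapping_expand[of a] by simp
  then show ?thesis by (simp only: sum_distrib_right smul_mult)
qed

text \<open>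
  Unless the product vanishes, an arc on the right cancels the last ghost arc. If there is none, it
  prolongs the path \<open>p\<close>, and the truncated subtraction records that the ghost path stays of length \<open>0\<close>.
\<close>

lemma path_pair_ed_reducible:
  assumes "Word ms \<in> path_pairs n" "e \<in> arcs E"
  shows "reducible (n - 1) (monom ms * ed e)"
proof -
  from assms(1) obtain p v q x u where m: "ms = path_pair p v q" "v \<notin> H_of E w"
    "awalk x p v" "awalk u q v" "length q \<le> n"
    by (auto elim: path_pairE)
  note gens = path_pairs_gens[OF assms(1)]
  show ?thesis
  proof (cases "u = tail E e")
    case False
    then show ?thesis
      using monom_other_ed[OF gens assms(2)] right_end_path_pair[OF m(4)] m(1)
      by (intro reducible_J) auto
  next
    case True
    show ?thesis
    proof (cases q)
      case Nil
      then have v: "v = tail E e" using m(4) True by (simp add: awalk_Nil_iff)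
      have p: "set (map Ed p) \<subseteq> gens E" using m(3) by (auto simp: gens_def awalk_def)
      have "monom ms * ed e = monom (map Ed p) * (vx v * ed e)"
        by (simp only: m(1) path_pair_def Nil rev.simps list.map monom_append mult.assoc)
      also have "\<dots> \<approx> monom (map Ed p) * ed e"
        unfolding v using assms(2) by (intro eqv_left p rel_vx_ed)
      also have "\<dots> \<approx> monom (map Ed p) * (ed e * vx (head E e))"
        using assms(2) by (intro eqv_left p eqv_sym[OF rel_ed_vx])
      also have "\<dots> = monom (path_pair (p @ [e]) (head E e) [])"
        by (simp add: path_pair_def mult_single plus_word_def)
      finally have *: "monom ms * ed e \<approx> monom (path_pair (p @ [e]) (head E e) [])" .
      have walk: "awalk x (p @ [e]) (head E e)"
        using m(3) assms(2) v by (auto simp: awalk_simps)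
      show ?thesis
      proof (cases "head E e \<in> H_of E w")
        case True
        have "monom (map Ed (p @ [e])) * vx (head E e) \<approx> monom (map Ed (p @ [e])) * 0"
          using vertices[OF True] p assms(2)
          by (intro eqv_left) (auto simp: eqv_zero_iff gens_def)
        then have "monom (path_pair (p @ [e]) (head E e) []) \<in> J"
          by (simp add: path_pair_def mult_single plus_word_def eqv_zero_iff)
        with * show ?thesis by (intro reducible_J) (rule eqv_J)
      next
        case False
        then show ?thesis
          using assms(2) walk
          by (intro reducible_eqv[OF *] reducible_monom path_pairI[where u = "head E e"])
            (auto simp: awalk_Nil_iff)
      qed
    next
      case (Cons f q')
      then have f: "f \<in> arcs E" "awalk (head E f) q' v" using m(4) by (auto simp: awalk_Cons_iff)
      note gens' = path_pair_gens[OF m(3) f(2)]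
      have eq: "monom ms * ed e = monom (path_pair p v q') * (gh f * ed e)"
        by (simp only: m(1) Cons path_pair_ghost monom_append mult.assoc)
      show ?thesis
      proof (cases "f = e")
        case True
        have "monom (path_pair p v q') * (gh f * ed e) \<approx> monom (path_pair p v q') * vx (head E f)"
          unfolding True using assms(2) gens' by (intro eqv_left rel_gh_ed)
        also have "\<dots> \<approx> monom (path_pair p v q')"
          using monom_vx[OF path_pair_nonempty gens', of "head E f"] right_end_path_pair[OF f(2)] f(1)
          by simp
        finally show ?thesis
          unfolding eq using m f Cons
          by (elim reducible_eqv) (intro reducible_monom path_pairI[of v x p "head E f"], auto)
      next
        case False
        have "monom (path_pair p v q') * (gh f * ed e) \<approx> monom (path_pair p v q') * 0"
          using False assms(2) f gens' by (intro eqv_left rel_gh_ed')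
        then show ?thesis unfolding eq by (intro reducible_J) (simp add: eqv_zero_iff)
      qed
    qed
  qed
qed

lemma path_pair_letter_reducible:
  assumes "Word ms \<in> path_pairs n" "g \<in> gens E"
  shows "reducible (Suc n) (monom ms * letter g)"
proof (cases g)
  case (Vx u)
  then have "u \<in> verts E" using assms(2) by (auto simp: gens_def)
  then show ?thesis
    using monom_vx[OF path_pairs_gens[OF assms(1)], of u] reducible_monom[OF assms(1)] Vx
    by (intro reducible_mono[of n "Suc n"])
      (auto intro: reducible_eqv reducible_J simp: eqv_zero_iff split: if_splits)
next
  case (Ed e)
  then have "e \<in> arcs E" using assms(2) by (auto simp: gens_def)
  then show ?thesis
    unfolding Ed by (intro reducible_mono[OF _ path_pair_ed_reducible[OF assms(1)]]) simp_all
next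
  case (Gh e)
  then have e: "e \<in> arcs E" using assms(2) by (auto simp: gens_def)
  from assms(1) obtain p v q x u where m: "ms = path_pair p v q" "v \<notin> H_of E w"
    "awalk x p v" "awalk u q v" "length q \<le> n"
    by (auto elim: path_pairE)
  show ?thesis
  proof (cases "u = head E e")
    case True
    have "monom ms * letter g = monom (path_pair p v (e # q))"
      by (simp only: m(1) Gh path_pair_ghost monom_append)
    moreover have "Word (path_pair p v (e # q)) \<in> path_pairs (Suc n)"
      using m e True by (intro path_pairI[of v x p "tail E e"]) (auto simp: awalk_Cons_iff)
    ultimately show ?thesis by (metis reducible_monom)
  next
    case False
    then show ?thesis
      unfolding Gh
      using monom_other_gh[OF path_pairs_gens[OF assms(1)] e] right_end_path_pair[OF m(4)] m(1)
      by (intro reducible_J) auto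
  qed
qed

lemma reducible_mult_letter:
  assumes "reducible n a" "g \<in> gens E"
  shows "reducible (Suc n) (a * letter g)"
proof -
  obtain b where b: "Poly_Mapping.keys b \<subseteq> path_pairs n" "a \<approx> b"
    using assms(1) by (auto simp: reducible_def)
  have "reducible (Suc n) (b * letter g)"
    unfolding mult_expand[of b]
  proof (intro reducible_sum reducible_smul path_pair_letter_reducible assms(2))
    fix m assume "m \<in> Poly_Mapping.keys b"
    then show "Word (letters m) \<in> path_pairs n" using b(1) by auto
  qed
  then show ?thesis
    using eqv_right[OF b(2) letter_closed[OF assms(2)]] by (rule reducible_eqv[rotated])
qed

text \<open>
  A word is built up from the left, starting with the left unit of its first letter. The bound is
  crude: a letter adds at most one ghost arc.
\<close>

lemma monom_reducible:
  assumes "ms \<noteq> []" "set ms \<subseteq> gens E"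
  shows "reducible (length ms) (monom ms)"
  using assms
proof (induction ms rule: rev_nonempty_induct)
  case (single g)
  obtain u where u: "u \<in> verts E" "vx u * letter g \<approx> letter g"
  proof (cases g)
    case (Vx v)
    then show ?thesis using that[of v] single rel_vx_vx by (auto simp: gens_def)
  next
    case (Ed e)
    then show ?thesis using that[of "tail E e"] single rel_vx_ed by (auto simp: gens_def)
  next
    case (Gh e)
    then show ?thesis using that[of "head E e"] single rel_vx_gh by (auto simp: gens_def)
  qed
  have "reducible 0 (vx u)"
  proof (cases "u \<in> H_of E w")
    case False
    then have "Word (path_pair [] u []) \<in> path_pairs 0"
      using u(1) by (intro path_pairI[of u u "[]" u]) (auto simp: awalk_Nil_iff)
    then show ?thesis using reducible_monom[of "path_pair [] u []" 0] by (simp add: path_pair_def)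
  qed (intro reducible_J vertices)
  then have "reducible 1 (vx u * letter g)" using reducible_mult_letter[of 0] single by simp
  then show ?case using reducible_eqv[OF eqv_sym[OF u(2)]] by simp
next
  case (snoc g ms)
  then show ?case using reducible_mult_letter[of "length ms" "monom ms" g]
    by (simp add: mult_single plus_word_def)
qed

lemma closed_reducible:
  assumes "a \<in> C"
  obtains n where "reducible n a"
proof -
  let ?n = "\<Sum>m\<in>Poly_Mapping.keys a. length (letters m)"
  have "reducible ?n (smul (Poly_Mapping.lookup a m) (monom (letters m)))"
    if m: "m \<in> Poly_Mapping.keys a" for m
  proof -
    have "letters m \<noteq> []" "set (letters m) \<subseteq> gens E" using m assms by (auto simp: free_alg_def)
    then have "reducible (length (letters m)) (monom (letters m))" by (rule monom_reducible)
    moreover have "length (letters m) \<le> ?n" using m by (intro member_le_sum) auto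
    ultimately show ?thesis by (intro reducible_smul) (rule reducible_mono)
  qed
  then have "reducible ?n (\<Sum>m\<in>Poly_Mapping.keys a. smul (Poly_Mapping.lookup a m) (monom (letters m)))"
    by (rule reducible_sum)
  then show ?thesis using that poly_mapping_expand[of a] by simp
qed


section \<open>Elements that act as zero\<close>

text \<open>The algebra has no unit in general, but the finitely many right ends of the words in \<open>a\<close> add
  up to a right unit for \<open>a\<close>.\<close>

lemma in_J_if_right_ends:
  assumes a: "a \<in> C" and J: "\<And>u. u \<in> verts E \<Longrightarrow> a * vx u \<in> J"
  shows "a \<in> J"
proof -
  let ?r = "\<lambda>m. right_end E (last (letters m))"
  let ?U = "?r ` Poly_Mapping.keys a"
  have m: "letters m \<noteq> []" "set (letters m) \<subseteq> gens E" if "m \<in> Poly_Mapping.keys a" for m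
    using that a by (auto simp: free_alg_def)
  have U: "?U \<subseteq> verts E" using m right_end_vert last_in_set by blast
  have *: "monom (letters m) * (\<Sum>u\<in>?U. vx u) \<approx> monom (letters m)"
    if "m \<in> Poly_Mapping.keys a" for m
  proof -
    have "monom (letters m) * (\<Sum>u\<in>?U. vx u) = (\<Sum>u\<in>?U. monom (letters m) * vx u)"
      by (rule sum_distrib_left)
    also have "\<dots> \<approx> (\<Sum>u\<in>?U. if u = ?r m then monom (letters m) else 0)"
      using m[OF that] U by (intro eqv_sum monom_vx) auto
    also have "\<dots> = monom (letters m)" using that by (simp add: sum.delta)
    finally show ?thesis .
  qed
  have "a * (\<Sum>u\<in>?U. vx u) \<approx> (\<Sum>m\<in>Poly_Mapping.keys a. smul (Poly_Mapping.lookup a m) (monom (letters m)))"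
    unfolding mult_expand[of a] by (intro eqv_sum eqv_smul *)
  then have "a \<approx> a * (\<Sum>u\<in>?U. vx u)"
    using poly_mapping_expand[of a] by (simp add: eqv_sym)
  moreover have "a * (\<Sum>u\<in>?U. vx u) \<in> J"
    unfolding sum_distrib_left using U by (intro J_sum J) auto
  ultimately show ?thesis by (rule eqv_J)
qed

lemma prepend_act:
  assumes "awalk x p v"
  shows "word_act E (Word (path_pair p v [])) (Poly_Mapping.single (u, \<gamma>) 1) =
    (if v = u then Poly_Mapping.single (x, p @ \<gamma>) 1 else (0 :: ('v, 'e, 'k) path_vec))"
proof -
  have "foldr (\<lambda>g. lin_ext (gen_act E g)) (map Ed p) (Poly_Mapping.single (v, \<gamma>) 1) =
      (Poly_Mapping.single (x, p @ \<gamma>) 1 :: ('v, 'e, 'k) path_vec)"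
    using assms by (induction p arbitrary: x) (auto simp: awalk_simps smul_laws)
  moreover have "foldr (\<lambda>g. lin_ext (gen_act E g)) (map Ed p) 0 = (0 :: ('v, 'e, 'k) path_vec)"
    by (induction p) auto
  ultimately show ?thesis by (cases "v = u") (simp_all add: word_act_def path_pair_def smul_laws)
qed

lemma ghost_act_zero:
  assumes "\<gamma> = [] \<or> hd \<gamma> \<noteq> f"
  shows "word_act E (Word (path_pair p v (f # q))) (Poly_Mapping.single (u, \<gamma>) 1) =
    (0 :: ('v, 'e, 'k) path_vec)"
proof -
  have "word_act E (Word [Gh f]) (Poly_Mapping.single (u, \<gamma>) 1) = (0 :: ('v, 'e, 'k) path_vec)"
    using assms by (cases \<gamma>) (auto simp: word_act_def smul_laws)
  moreover have "Word (path_pair p v (f # q)) = Word (path_pair p v q) + Word [Gh f]"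
    by (simp add: path_pair_ghost plus_word_def)
  ultimately show ?thesis by (simp add: word_act_plus)
qed

text \<open>
  A path \<open>\<gamma>\<close> from \<open>u\<close> to \<open>w\<close> that no ghost path of \<open>a\<close> shortens detects the coefficients of \<open>a\<close> at
  the paths \<open>p\<close> ending in \<open>u\<close>: these are the coefficients of \<open>a\<gamma>\<close> at the distinct paths \<open>p\<gamma>\<close>.
\<close>

lemma real_coefficients_vanish:
  fixes a :: "('v, 'e, 'k) lpa_free"
  assumes a: "Poly_Mapping.keys a \<subseteq> path_pairs n"
    and zero: "\<And>x. x \<in> path_mod E w \<Longrightarrow> free_act E a x = 0"
    and walk: "awalk u \<gamma> w"
    and avoid: "\<And>p v f q. Word (path_pair p v (f # q)) \<in> Poly_Mapping.keys a \<Longrightarrow> \<gamma> = [] \<or> hd \<gamma> \<noteq> f"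
    and p: "awalk x p u"
  shows "Poly_Mapping.lookup a (Word (path_pair p u [])) = 0" (is "Poly_Mapping.lookup a ?m0 = 0")
proof -
  let ?s = "Poly_Mapping.single (u, \<gamma>) 1 :: ('v, 'e, 'k) path_vec"
  have other: "Poly_Mapping.lookup (word_act E m ?s) (x, p @ \<gamma>) = 0"
    if m: "m \<in> Poly_Mapping.keys a" "m \<noteq> ?m0" for m
  proof -
    from subsetD[OF a m(1)] obtain p' v q x' u' where m': "m = Word (path_pair p' v q)"
      "awalk x' p' v" "awalk u' q v"
      by (auto elim: path_pairE)
    show ?thesis
    proof (cases q)
      case Nil
      then show ?thesis
        using m' m(2) by (auto simp: prepend_act lookup_single when_def)
    next
      case (Cons f q')
      then show ?thesis using m' m avoid ghost_act_zero by auto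
    qed
  qed
  have "?s \<in> path_mod E w" using walk by (simp add: path_mod_def)
  then have "0 = Poly_Mapping.lookup (free_act E a ?s) (x, p @ \<gamma>)" using zero by simp
  also have "\<dots> = (\<Sum>m\<in>Poly_Mapping.keys a.
      Poly_Mapping.lookup a m * Poly_Mapping.lookup (word_act E m ?s) (x, p @ \<gamma>))"
    by (simp add: free_act_def lin_ext_def lookup_sum)
  also have "\<dots> = (\<Sum>m\<in>Poly_Mapping.keys a. if m = ?m0 then Poly_Mapping.lookup a ?m0 else 0)"
    using p by (intro sum.cong refl) (auto simp: other prepend_act)
  also have "\<dots> = Poly_Mapping.lookup a ?m0"
    by (simp add: sum.delta in_keys_iff)
  finally show ?thesis by simp
qed

text \<open>If all monomials of \<open>a\<close> with right end \<open>u\<close> have a ghost arc, then the projections \<open>ff\<^sup>*\<close> for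
  the last ghost arcs \<open>f\<close> add up to a right unit for them.\<close>

lemma ghost_expansion:
  assumes a: "Poly_Mapping.keys a \<subseteq> path_pairs n"
    and u: "u \<in> verts E"
    and ghost: "\<And>x p. awalk x p u \<Longrightarrow> Word (path_pair p u []) \<notin> Poly_Mapping.keys a"
    and F: "finite F" "F \<subseteq> out_arcs E u"
      "\<And>p v f q. Word (path_pair p v (f # q)) \<in> Poly_Mapping.keys a \<Longrightarrow> f \<in> out_arcs E u \<Longrightarrow> f \<in> F"
  shows "a * vx u \<approx> (\<Sum>f\<in>F. a * ed f * gh f)"
proof -
  let ?P = "\<Sum>f\<in>F. ed f * gh f"
  have Fa: "f \<in> arcs E" "tail E f = u" if "f \<in> F" for f
    using F(2) that by auto
  have *: "monom (letters m) * vx u \<approx> monom (letters m) * ?P"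
    if "m \<in> Poly_Mapping.keys a" for m
  proof -
    from subsetD[OF a that] obtain p v q x u' where m: "m = Word (path_pair p v q)"
      "awalk x p v" "awalk u' q v"
      by (auto elim: path_pairE)
    note gens = path_pair_gens[OF m(2,3)]
    have left: "monom (letters m) * vx u \<approx> (if u = u' then monom (letters m) else 0)"
      using monom_vx[OF path_pair_nonempty gens u] unfolding right_end_path_pair[OF m(3)] m(1) word.sel .
    have right: "monom (letters m) * (ed f * gh f) \<approx>
        (if q \<noteq> [] \<and> f = hd q then monom (letters m) else 0)"
      if f: "f \<in> F" for f
    proof (cases q)
      case Nil
      then have "right_end E (last (path_pair p v q)) \<noteq> u"
        using right_end_path_pair[OF m(3)] m ghost \<open>m \<in> Poly_Mapping.keys a\<close>
        by (auto simp: awalk_Nil_iff)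
      then have "monom (letters m) * ed f \<in> J"
        using monom_other_ed[OF path_pair_nonempty gens] Fa[OF f] m(1) by auto
      then show ?thesis
        using J_right[of _ "gh f"] Fa[OF f] Nil by (simp add: eqv_zero_iff flip: mult.assoc)
    next
      case (Cons h q')
      then have h: "h \<in> arcs E" "awalk (head E h) q' v" using m(3) by (auto simp: awalk_Cons_iff)
      note gens' = path_pair_gens[OF m(2) h(2)]
      have "monom (letters m) * (ed f * gh f) = monom (path_pair p v q') * (gh h * ed f * gh f)"
        by (simp only: m(1) Cons word.sel path_pair_ghost monom_append mult.assoc)
      also have "\<dots> \<approx> monom (path_pair p v q') * (if h = f then gh f else 0)"
      proof (rule eqv_left[OF _ gens'])
        show "gh h * ed f * gh f \<approx> (if h = f then gh f else 0)"
        proof (cases "h = f")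
          case True
          have "gh f * ed f * gh f \<approx> vx (head E f) * gh f"
            using Fa[OF f] by (intro eqv_right rel_gh_ed) auto
          also have "\<dots> \<approx> gh f" using Fa[OF f] by (intro rel_vx_gh)
          finally show ?thesis using True by simp
        next
          case False
          then have "gh h * ed f * gh f \<approx> 0 * gh f"
            using Fa[OF f] h by (intro eqv_right rel_gh_ed') auto
          then show ?thesis using False by simp
        qed
      qed
      also have "\<dots> = (if q \<noteq> [] \<and> f = hd q then monom (letters m) else 0)"
        by (auto simp: m(1) Cons path_pair_ghost mult_single plus_word_def)
      finally show ?thesis .
    qed
    have mem: "u = u' \<longleftrightarrow> q \<noteq> [] \<and> hd q \<in> F"
    proof (cases q)
      case Nil
      then show ?thesis using m ghost that by (auto simp: awalk_Nil_iff)
    next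
      case (Cons h q')
      then have h: "h \<in> arcs E" "tail E h = u'" using m(3) by (auto simp: awalk_Cons_iff)
      moreover have "h \<in> F" if "h \<in> out_arcs E u"
        using F(3)[of p v h q'] that \<open>m \<in> Poly_Mapping.keys a\<close> m(1) Cons by simp
      ultimately show ?thesis using Cons Fa[of h] by auto
    qed
    have "monom (letters m) * ?P = (\<Sum>f\<in>F. monom (letters m) * (ed f * gh f))"
      by (rule sum_distrib_left)
    also have "\<dots> \<approx> (\<Sum>f\<in>F. if q \<noteq> [] \<and> f = hd q then monom (letters m) else 0)"
      by (intro eqv_sum right)
    also have "\<dots> = (if u = u' then monom (letters m) else 0)"
      using F(1) by (cases "q = []") (simp_all add: mem sum.delta)
    finally show ?thesis using left eqv_sym eqv_trans by blast
  qed
  have "a * vx u \<approx> a * ?P"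
    unfolding mult_expand[of a] by (intro eqv_sum eqv_smul *)
  also have "\<dots> = (\<Sum>f\<in>F. a * ed f * gh f)"
    by (simp only: sum_distrib_left mult.assoc)
  finally show ?thesis .
qed

text \<open>
  Induction on the length of the ghost paths: multiplication by an arc on the right shortens them, so
  it suffices to write \<open>au\<close> modulo \<open>J\<close> as a finite sum of elements \<open>aee\<^sup>*\<close>. If \<open>a\<close> has no ghost arcs at
  all, then nothing gets shorter, but in this case the sum is empty.
\<close>

lemma act_zero_imp_in_J:
  assumes "Poly_Mapping.keys a \<subseteq> path_pairs n"
    and "\<And>x. x \<in> path_mod E w \<Longrightarrow> free_act E a x = 0"
  shows "a \<in> J"
  using assms
proof (induction n arbitrary: a rule: less_induct)
  case (less n)
  note a = less.prems(1) and zero = less.prems(2)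
  \<comment> \<open>The first arcs of the ghost paths \<open>q\<close>: the word of \<open>pq\<^sup>*\<close> ends in the first arc of \<open>q\<close>.\<close>
  let ?F = "{f. Gh f \<in> (\<lambda>m. last (letters m)) ` Poly_Mapping.keys a}"
  have "finite (Gh -` ((\<lambda>m. last (letters m)) ` Poly_Mapping.keys a) :: 'e set)"
    by (intro finite_vimageI) (auto simp: inj_def)
  then have finF: "finite ?F" by (simp add: vimage_def)
  have F: "f \<in> ?F" if "Word (path_pair p v (f # q)) \<in> Poly_Mapping.keys a" for p v f q
    using imageI[OF that, of "\<lambda>m. last (letters m)"] by (simp add: path_pair_ghost)
  have step: "a * ed f \<in> J" if f: "f \<in> arcs E" and n: "0 < n" for f
  proof -
    have "reducible (n - 1) (a * ed f)"
      unfolding mult_expand[of a]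
    proof (intro reducible_sum reducible_smul path_pair_ed_reducible f)
      fix m assume "m \<in> Poly_Mapping.keys a"
      then show "Word (letters m) \<in> path_pairs n" using a by auto
    qed
    then obtain b where b: "Poly_Mapping.keys b \<subseteq> path_pairs (n - 1)" "a * ed f \<approx> b"
      by (auto simp: reducible_def)
    have "b \<in> J"
    proof (rule less.IH[OF _ b(1)])
      fix x :: "('v, 'e, 'k) path_vec" assume x: "x \<in> path_mod E w"
      have "free_act E (a * ed f) x = 0"
        unfolding free_act_mult using x f wf_digraph_axioms
        by (intro zero free_act_closed) auto
      moreover have "free_act E (a * ed f - b) x = 0"
        using b(2) x by (intro annihilates) (auto simp: eqv_def)
      ultimately show "free_act E b x = 0" by (simp add: free_act_left)
    qed (use n in simp)
    with b(2) show ?thesis by (rule eqv_J)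
  qed
  show ?case
  proof (rule in_J_if_right_ends[OF lin_path_pairs_C[OF a]])
    fix u assume u: "u \<in> verts E"
    show "a * vx u \<in> J"
    proof (cases "u \<in> H_of E w")
      case True
      then show ?thesis using J_left[OF vertices lin_path_pairs_C[OF a]] by blast
    next
      case outside: False
      show ?thesis
      proof (cases "\<exists>\<gamma>. awalk u \<gamma> w \<and> (\<forall>f\<in>?F. \<gamma> = [] \<or> hd \<gamma> \<noteq> f)")
        case True
        then obtain \<gamma> where \<gamma>: "awalk u \<gamma> w" "\<forall>f\<in>?F. \<gamma> = [] \<or> hd \<gamma> \<noteq> f" by blast
        have "Poly_Mapping.lookup a (Word (path_pair p u [])) = 0" if "awalk x p u" for x p
          by (rule real_coefficients_vanish[OF a zero \<gamma>(1) _ that]) (assumption, rule bspec[OF \<gamma>(2) F])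
        then have ghost: "Word (path_pair p u []) \<notin> Poly_Mapping.keys a" if "awalk x p u" for x p
          using that by (simp add: in_keys_iff)
        have "a * vx u \<approx> (\<Sum>f\<in>?F \<inter> out_arcs E u. a * ed f * gh f)"
          using finF F by (intro ghost_expansion[OF a u ghost]) auto
        moreover have "(\<Sum>f\<in>?F \<inter> out_arcs E u. a * ed f * gh f) \<in> J"
        proof (rule J_sum)
          fix f assume f: "f \<in> ?F \<inter> out_arcs E u"
          \<comment> \<open>A member of this index set witnesses a ghost arc, which makes the induction applicable.\<close>
          then obtain m where m: "m \<in> Poly_Mapping.keys a" "Gh f = last (letters m)" by auto
          with a obtain p v q where q: "m = Word (path_pair p v q)" "length q \<le> n"
            by (blast elim: path_pairE)
          with m(2) have "q \<noteq> []" by (auto simp: path_pair_def)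
          with q(2) have "0 < n" by (cases q) auto
          then show "a * ed f * gh f \<in> J" using f by (intro J_right step) auto
        qed
        ultimately show ?thesis by (rule eqv_J)
      next
        case False
        then have avoid: "\<exists>f\<in>?F. \<gamma> \<noteq> [] \<and> hd \<gamma> = f" if "awalk u \<gamma> w" for \<gamma>
          using that by blast
        obtain \<gamma> where \<gamma>: "awalk u \<gamma> w" using outside u by (auto simp: H_of_def path_ge_def)
        have "u \<noteq> w" using avoid[of "[]"] u by (auto simp: awalk_Nil_iff)
        have sub: "arcs_outside E (H_of E w) u \<subseteq> ?F"
        proof
          fix e assume "e \<in> arcs_outside E (H_of E w) u"
          then obtain \<delta> where "awalk u (e # \<delta>) w"
            by (auto simp: arcs_outside_def H_of_def path_ge_def awalk_Cons_iff)
          from avoid[OF this] show "e \<in> ?F" by auto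
        qed
        obtain m f where m: "m \<in> Poly_Mapping.keys a" "Gh f = last (letters m)"
          using avoid[OF \<gamma>] by auto
        with a obtain p v q where q: "m = Word (path_pair p v q)" "length q \<le> n"
          by (blast elim: path_pairE)
        with m(2) have "q \<noteq> []" by (auto simp: path_pair_def)
        with q(2) have n: "0 < n" by (cases q) auto
        have "vx u \<approx> (\<Sum>e\<in>arcs_outside E (H_of E w) u. ed e * gh e)"
          by (rule vx_outside_expansion[OF u outside \<open>u \<noteq> w\<close> finite_subset[OF sub finF]])
        from J_left[OF this[unfolded eqv_def] lin_path_pairs_C[OF a]]
        have "a * vx u \<approx> (\<Sum>e\<in>arcs_outside E (H_of E w) u. a * ed e * gh e)"
          by (simp add: eqv_def right_diff_distrib sum_distrib_left mult.assoc)
        moreover have "(\<Sum>e\<in>arcs_outside E (H_of E w) u. a * ed e * gh e) \<in> J"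
          by (intro J_sum J_right step n) (auto simp: arcs_outside_def)
        ultimately show ?thesis by (rule eqv_J)
      qed
    qed
  qed
qed

theorem annihilating_imp_in_J:
  assumes "a \<in> C" and zero: "\<And>x. x \<in> path_mod E w \<Longrightarrow> free_act E a x = 0"
  shows "a \<in> J"
proof -
  obtain n b where b: "Poly_Mapping.keys b \<subseteq> path_pairs n" "a \<approx> b"
    using closed_reducible[OF assms(1)] unfolding reducible_def by metis
  have "b \<in> J"
  proof (rule act_zero_imp_in_J[OF b(1)])
    fix x :: "('v, 'e, 'k) path_vec" assume "x \<in> path_mod E w"
    then have "free_act E (a - b) x = 0" "free_act E a x = 0"
      using b(2) zero by (auto simp: eqv_def intro: annihilates)
    then show "free_act E b x = 0" by (simp add: free_act_left)
  qed
  with b(2) show ?thesis by (rule eqv_J)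
qed

end


section \<open>The annihilator\<close>

text \<open>
  That the preimage acts as zero is the inclusion proved first. It makes \<open>a\<close> and \<open>b\<close> act alike
  whenever \<open>a \<approx> b\<close>, and this lets the reduction to monomials \<open>pq\<^sup>*\<close> preserve acting as zero.
\<close>

lemma annihilating_ideal_preimage:
  fixes E :: "('v, 'e) pre_digraph"
  assumes "wf_digraph E" "sink E w"
  shows "annihilating_ideal E w {a :: ('v, 'e, 'k::field) lpa_free. a \<in> carrier (free_alg (gens E)) \<and>
    lpa_class E a \<in> lpa_ideal E (H_of E w) (breaking E (H_of E w))}"
    (is "annihilating_ideal E w {a. a \<in> ?C \<and> lpa_class E a \<in> ?I}")
proof -
  interpret wf_digraph E by fact
  have vx: "vx v \<in> ?C" if "v \<in> H_of E w" for v
    using that by (intro letter_closed) (auto simp: H_of_def gens_def)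
  have gap: "gap E (H_of E w) u \<in> ?C" if "u \<in> breaking E (H_of E w)" for u
    using that by (intro gap_closed) (auto simp: breaking_def)
  have I: "alg_ideal (lpa E) ?I"
    unfolding lpa_ideal_def using vx gap assms(1)
    by (intro ideal_gen_ideal lpa_carrier_ideal) (auto simp: lpa_carrier)
  have I_zero: "lpa_class E 0 \<in> ?I"
    using I by (simp add: alg_ideal_def lpa_zero)
  show ?thesis
  proof unfold_locales
    show "alg_ideal (free_alg (gens E)) {a. a \<in> ?C \<and> lpa_class E a \<in> ?I}"
    proof -
      have sel: "azero (free_alg X) = 0" "aplus (free_alg X) = (+)" "atimes (free_alg X) = (*)"
        "ascale (free_alg X) = smul" for X :: "('v, 'e) lpa_gen set"
        by (simp_all add: free_alg_def)
      note I' = I[unfolded alg_ideal_def]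
      have "lpa_class E (a + b) \<in> ?I" "lpa_class E (smul c a) \<in> ?I"
        if "a \<in> ?C" "b \<in> ?C" "lpa_class E a \<in> ?I" "lpa_class E b \<in> ?I" for a b c
        using I' that unfolding lpa_ops(2,4)[OF assms(1) that(1,2), symmetric] by blast+
      moreover have "lpa_class E (a * b) \<in> ?I" "lpa_class E (b * a) \<in> ?I"
        if "a \<in> ?C" "b \<in> ?C" "lpa_class E a \<in> ?I" for a b
        using I' that lpa_ops(1)[OF assms(1) that(2,1)]
        unfolding lpa_ops(3)[OF assms(1) that(1,2), symmetric]
          lpa_ops(3)[OF assms(1) that(2,1), symmetric]
        by blast+
      ultimately show ?thesis
        unfolding alg_ideal_def sel
        by (auto simp: free_alg_closed free_alg_smul free_alg_zero I_zero)
    qed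
  next
    show "lpa_rels E \<subseteq> {a. a \<in> ?C \<and> lpa_class E a \<in> ?I}"
    proof
      fix r :: "('v, 'e, 'k) lpa_free" assume r: "r \<in> lpa_rels E"
      then have "r - 0 \<in> lpa_rel_ideal E" by (auto simp: lpa_rel_ideal_def ideal_gen_def)
      then have "lpa_class E r = lpa_class E 0" by (simp only: lpa_class_eq_iff[OF assms(1)])
      then show "r \<in> {a. a \<in> ?C \<and> lpa_class E a \<in> ?I}"
        using r lpa_rels_closed[OF assms(1)] I_zero by auto
    qed
  next
    fix v assume "v \<in> H_of E w"
    then show "vx v \<in> {a. a \<in> ?C \<and> lpa_class E a \<in> ?I}"
      using vx by (auto simp: lpa_ideal_def ideal_gen_def)
  next
    fix u assume "u \<in> breaking E (H_of E w)"
    then show "gap E (H_of E w) u \<in> {a. a \<in> ?C \<and> lpa_class E a \<in> ?I}"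
      using gap by (auto simp: lpa_ideal_def ideal_gen_def)
  next
    fix j :: "('v, 'e, 'k) lpa_free" and x :: "('v, 'e, 'k) path_vec"
    assume j: "j \<in> {a. a \<in> ?C \<and> lpa_class E a \<in> ?I}" and x: "x \<in> path_mod E w"
    then have "lpa_class E j \<in> annihilator (lpa E) (lpa_act E) (path_mod E w)"
      using lpa_ideal_subset_annihilator[OF assms] by blast
    then show "free_act E j x = 0" using annihilator_class_iff[OF assms] j x by blast
  qed
qed

theorem lemma3p1:
  fixes E :: "('v, 'e) pre_digraph" and w :: 'v
  assumes "wf_digraph E" and "sink E w"
  shows "annihilator (lpa E :: ('k::field, ('v, 'e, 'k) lpa_elem) alg) (lpa_act E) (path_mod E w)
           = lpa_ideal E (H_of E w) (breaking E (H_of E w))"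
proof
  interpret annihilating_ideal E w "{a :: ('v, 'e, 'k) lpa_free. a \<in> carrier (free_alg (gens E)) \<and>
      lpa_class E a \<in> lpa_ideal E (H_of E w) (breaking E (H_of E w))}"
    by (rule annihilating_ideal_preimage[OF assms])
  show "annihilator (lpa E :: ('k, ('v, 'e, 'k) lpa_elem) alg) (lpa_act E) (path_mod E w)
      \<subseteq> lpa_ideal E (H_of E w) (breaking E (H_of E w))"
  proof
    fix X :: "('v, 'e, 'k) lpa_elem"
    assume X: "X \<in> annihilator (lpa E) (lpa_act E) (path_mod E w)"
    then obtain a where a: "X = lpa_class E a" "a \<in> carrier (free_alg (gens E))"
      by (auto simp: annihilator_def lpa_carrier)
    then have "free_act E a x = 0" if "x \<in> path_mod E w" for x
      using X that annihilator_class_iff[OF assms] by blast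
    from annihilating_imp_in_J[OF a(2) this] a(1)
    show "X \<in> lpa_ideal E (H_of E w) (breaking E (H_of E w))" by simp
  qed
qed (rule lpa_ideal_subset_annihilator[OF assms])

end
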